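(* (i) For $6\le n\le 9$: $\mathrm{ex}_3(n;\{P,C\}\mid M)=2n-4$. (ii) For $n=10$: $\mathrm{ex}_3(10;\{P,C\}\mid M)=20$. (iii) For $n\ge 11$: $\mathrm{ex}_3(n;\{P,C\}\mid M)=4+\binom{n-4}{2}$ and $\mathrm{Ex}_3(n;\{P,C\}\mid M)=\{\mathrm{Co}(n)\}$.
   Context: All hypergraphs are 3-uniform; containment means containing an isomorphic copy. $P$ is the loose 3-uniform path of length 3: vertices $a,b,c,d,e,f,g$, edges $\{a,b,c\},\{c,d,e\},\{e,f,g\}$. $C$ is the loose triangle: vertices $x_1,x_2,x_3,y_1,y_2,y_3$, edges $\{x_1,y_3,x_2\},\{x_2,y_1,x_3\},\{x_3,y_2,x_1\}$. $M$ is the 3-graph consisting of two disjoint edges. The comet $\mathrm{Co}(n)$ is the $n$-vertex 3-graph with vertex set $\{c,h_1,h_2,h_3\}\cup R$, $|R|=n-4$, whose edges are the four triples of $\{c,h_1,h_2,h_3\}$ together with all triples $\{c,u,v\}$ with $u,v\in R$. Conditional Turán number: $\mathrm{ex}_3(n;\mathcal F\mid\mathcal G)$ is the maximum number of edges of an $n$-vertex 3-graph $H$ that contains no member of $\mathcal F$ and contains some member of $\mathcal G$; $\mathrm{Ex}_3(n;\mathcal F\mid\mathcal G)$ is the family (up to isomorphism) of such $H$ attaining the maximum. *)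

theory Defs
  imports Main
begin

definition hypergraph3 :: "nat \<Rightarrow> nat set set \<Rightarrow> bool" where
  "hypergraph3 n E \<longleftrightarrow> (\<forall>e\<in>E. e \<subseteq> {0..<n} \<and> card e = 3)"

text \<open>E contains an isomorphic copy of the pattern F (F has no isolated vertices,
  so its vertex set is the union of its edges).\<close>
definition contains :: "nat set set \<Rightarrow> nat set set \<Rightarrow> bool" where
  "contains E F \<longleftrightarrow> (\<exists>f :: nat \<Rightarrow> nat. inj_on f (\<Union>F) \<and> (\<forall>e\<in>F. f ` e \<in> E))"

definition P3 :: "nat set set" where
  "P3 = {{0,1,2},{2,3,4},{4,5,6}}"

definition C3 :: "nat set set" where
  "C3 = {{0,5,1},{1,3,2},{2,4,0}}"

definition M2 :: "nat set set" where
  "M2 = {{0,1,2},{3,4,5}}"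

definition comet :: "nat \<Rightarrow> nat set set" where
  "comet n = {e. e \<subseteq> {0,1,2,3} \<and> card e = 3}
     \<union> {{0,u,v} | u v. u \<in> {4..<n} \<and> v \<in> {4..<n} \<and> u \<noteq> v}"

definition admissible :: "nat \<Rightarrow> nat set set \<Rightarrow> bool" where
  "admissible n E \<longleftrightarrow> hypergraph3 n E \<and> \<not> contains E P3 \<and> \<not> contains E C3 \<and> contains E M2"

definition ex3 :: "nat \<Rightarrow> nat" where
  "ex3 n = Max {card E | E. admissible n E}"

text \<open>Extremal family Ex_3(n; {P,C} | M) (as labelled hypergraphs on {0..<n}).\<close>
definition Ex3 :: "nat \<Rightarrow> nat set set set" where
  "Ex3 n = {E. admissible n E \<and> card E = ex3 n}"

definition iso_hg :: "nat \<Rightarrow> nat set set \<Rightarrow> nat set set \<Rightarrow> bool" where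
  "iso_hg n E F \<longleftrightarrow> (\<exists>f. bij_betw f {0..<n} {0..<n} \<and> (\<lambda>e. f ` e) ` E = F)"

end

theory Submission
  imports Defs
begin

text \<open>
  If e and f are disjoint edges, an edge g meeting both lies inside e \<union> f, for otherwise e, g, f is
  a loose path. When no such g exists for any e and f, the edges meeting e and those missing e live
  on disjoint vertex sets, and the bound for {P, C}-free graphs without a matching (a full star, or
  few edges) can be added up. Otherwise the edges crossing from e to f split into those with two
  vertices in e and those with two vertices in f; C-freeness leaves at most three of each kind. If
  two crossing edges of different kinds intersect, almost every other edge contains one of two
  fixed pairs, and there are few edges. If every crossing edge has two vertices in e and at least
  two pairs of e occur, then at most four edges meet e; deleting e leaves at most a full star,
  and equality forces the comet. In all remaining cases some pair p is contained in every edge it meets,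
  and the remaining edges are bounded by induction.
\<close>

section \<open>Numerical bounds\<close>

text \<open>The three regimes come from three competing constructions: two books on the spines {0,
  1} and {2, 3} have 2n - 4 edges, two disjoint complete graphs on five vertices have 20, and the
  comet adds a star on n - 3 vertices to four triples. For n \<le> 10 no single structure can be
  aimed at, so there the branches are closed by counting alone. The main obstacle is that deleting
  an edge or a pair may destroy the matching, so the bound for graphs with a matching does not
  suffice as an induction hypothesis. Since such graphs never exceed \<open>star_bound\<close>, that
  weaker bound and its equality case are available for all smaller graphs. The count "four edges
  plus a star" breaks down at n = 8: the five vertices left could carry ten edges, and 14 exceeds
  12. There a further path argument, through the common vertex of the crossing edges, caps the rest
  at eight.\<close>

text \<open>The maximal number of edges of a {P, C}-free graph on \<open>m\<close> vertices; the two regimes are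
  complete graphs and full stars.\<close>
definition star_bound :: "nat \<Rightarrow> nat" where
  "star_bound m = (if m \<le> 5 then m choose 3 else (m - 1) choose 2)"

definition turan_M :: "nat \<Rightarrow> nat" where
  "turan_M n = (if n \<le> 9 then 2 * n - 4 else if n = 10 then 20 else 4 + ((n - 4) choose 2))"

text \<open>For \<open>n \<ge> 11\<close> the bound is lowered by one, so that configurations other than the comet
  are kept strictly below the extremal value.\<close>
definition turan_M_slack :: "nat \<Rightarrow> nat" where
  "turan_M_slack n = (if n \<le> 10 then turan_M n else turan_M n - 1)"

lemma two_choose_two: "2 * (n choose 2) = n * (n - 1)"
proof -
  have "even (n * (n - 1))" by (cases n) auto
  then show ?thesis by (simp add: choose_two)
qed

lemma star_bound_small [simp]:
  "star_bound 0 = 0" "star_bound (Suc 0) = 0" "star_bound 2 = 0" "star_bound 3 = 1"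
  "star_bound 4 = 4" "star_bound 5 = 10"
  by (simp_all add: star_bound_def eval_nat_numeral)

lemma turan_M_small [simp]:
  "turan_M 6 = 8" "turan_M 7 = 10" "turan_M 8 = 12" "turan_M 9 = 14" "turan_M 10 = 20"
  by (simp_all add: turan_M_def)

text \<open>Doubling clears the division in the binomial: with m = 6 + k the value is (k + 4)(k +
  5), which linear arithmetic can compare once \<open>k * k\<close> counts as an atom. The next two
  lemmas do the same from 11 on, where the comet takes over.\<close>

lemma star_bound_large: "2 * star_bound (6 + k) = k * k + 9 * k + 20"
  using two_choose_two[of "5 + k"] by (simp add: star_bound_def algebra_simps)

lemma turan_M_large: "2 * turan_M (11 + k) = k * k + 13 * k + 50"
  using two_choose_two[of "7 + k"] by (simp add: turan_M_def algebra_simps)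

lemma turan_M_slack_large: "2 * turan_M_slack (11 + k) = k * k + 13 * k + 48"
  using turan_M_large[of k] by (simp add: turan_M_slack_def)

lemma turan_M_slack_small [simp]: "n \<le> 10 \<Longrightarrow> turan_M_slack n = turan_M n"
  by (simp add: turan_M_slack_def)

lemma turan_M_slack_le: "turan_M_slack n \<le> turan_M n"
  by (simp add: turan_M_slack_def)

lemma turan_M_slack_less: "11 \<le> n \<Longrightarrow> turan_M_slack n < turan_M n"
  by (simp add: turan_M_slack_def turan_M_def)

lemma nat_le_5_cases: "(m::nat) \<le> 5 \<Longrightarrow> m = 0 \<or> m = 1 \<or> m = 2 \<or> m = 3 \<or> m = 4 \<or> m = 5"
  by auto

lemma nat_6_10_cases: "6 \<le> (m::nat) \<Longrightarrow> m \<le> 10 \<Longrightarrow> m = 6 \<or> m = 7 \<or> m = 8 \<or> m = 9 \<or> m = 10"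
  by auto

lemma star_bound_mono: "a \<le> b \<Longrightarrow> star_bound a \<le> star_bound b"
proof (cases "b \<le> 5")
  case True
  then show "a \<le> b \<Longrightarrow> star_bound a \<le> star_bound b"
    using nat_le_5_cases[of b] nat_le_5_cases[of a] by auto
next
  case False
  then obtain j where j: "b = 6 + j" using le_Suc_ex[of 6 b] by auto
  assume ab: "a \<le> b"
  show "star_bound a \<le> star_bound b"
  proof (cases "a \<le> 5")
    case True
    then show ?thesis using nat_le_5_cases[of a] star_bound_large[of j] j by auto
  next
    case False
    then obtain i where i: "a = 6 + i" using le_Suc_ex[of 6 a] by auto
    have "i * i \<le> j * j" using ab i j by (simp add: mult_le_mono)
    then show ?thesis using star_bound_large[of i] star_bound_large[of j] ab unfolding i j by linarith
  qed
qed

text \<open>Turns the bound for graphs with a matching into one valid for all smaller graphs. The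
  strict part excludes graphs with a matching from the equality case of
  \<open>star_bound\<close>.\<close>

lemma turan_M_le_star_bound:
  assumes "6 \<le> n"
  shows "turan_M n \<le> star_bound n" and "8 \<le> n \<Longrightarrow> turan_M n < star_bound n"
proof -
  obtain k where k: "n = 6 + k" using assms le_Suc_ex[of 6 n] by auto
  have *: "turan_M n \<le> star_bound n \<and> (8 \<le> n \<longrightarrow> turan_M n < star_bound n)"
  proof (cases "n \<le> 10")
    case True
    then show ?thesis using nat_6_10_cases[OF assms] star_bound_large[of k] k by auto
  next
    case False
    then obtain i where i: "n = 11 + i" using le_Suc_ex[of 11 n] by auto
    then show ?thesis using star_bound_large[of "5 + i"] turan_M_large[of i] by (simp add: algebra_simps)
  qed
  show "turan_M n \<le> star_bound n" "8 \<le> n \<Longrightarrow> turan_M n < star_bound n" using * by auto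
qed

text \<open>Serves graphs that fall apart into two vertex-disjoint pieces. Equality occurs for 5 +
  5, which is the value 20 at n = 10, and for 4 + 5, where 4 + 10 = 2 * 9 - 4.\<close>

lemma star_bound_add_le:
  assumes "3 \<le> a" "3 \<le> b"
  shows "star_bound a + star_bound b \<le> turan_M_slack (a + b)"
proof -
  have small_large: "star_bound a + star_bound b \<le> turan_M_slack (a + b)"
    if "3 \<le> a" "a \<le> 5" "6 \<le> b" for a b
  proof -
    obtain k where k: "b = 6 + k" using \<open>6 \<le> b\<close> le_Suc_ex by blast
    consider "a = 3" | "a = 4" | "a = 5" using \<open>3 \<le> a\<close> \<open>a \<le> 5\<close> by linarith
    then show ?thesis
    proof cases
      case 1
      consider "k = 0" | "k = 1" | i where "k = Suc (Suc i)" by (metis One_nat_def not0_implies_Suc)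
      then show ?thesis
        using star_bound_large[of k] turan_M_slack_large[of "k - 2"] 1 k by cases auto
    next
      case 2
      consider "k = 0" | i where "k = Suc i" by (metis not0_implies_Suc)
      then show ?thesis
        using star_bound_large[of k] turan_M_slack_large[of "k - 1"] 2 k by cases auto
    next
      case 3
      then show ?thesis using star_bound_large[of k] turan_M_slack_large[of k] k by auto
    qed
  qed
  consider "a \<le> 5" "b \<le> 5" | "a \<le> 5" "6 \<le> b" | "6 \<le> a" "b \<le> 5" | "6 \<le> a" "6 \<le> b" by linarith
  then show ?thesis
  proof cases
    case 1
    then show ?thesis using assms nat_le_5_cases[of a] nat_le_5_cases[of b] by auto
  next
    case 2
    then show ?thesis using small_large assms by simp
  next
    case 3
    then show ?thesis using small_large[of b a] assms by (simp add: add.commute)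
  next
    case 4
    obtain i j where ij: "a = 6 + i" "b = 6 + j" using 4 le_Suc_ex[of 6 a] le_Suc_ex[of 6 b] by auto
    then have "a + b = 11 + (1 + i + j)" by simp
    then show ?thesis
      using star_bound_large[of i] star_bound_large[of j] turan_M_slack_large[of "1 + i + j"] ij
      by (simp add: algebra_simps)
  qed
qed

text \<open>The 4 bounds the edges at e, and n - 3 vertices remain. For n = 8 the remaining five
  vertices allow ten edges and 14 > 12. The variant with 2 is the extreme case of a pair with two
  extensions.\<close>

lemma four_plus_star_bound:
  assumes "6 \<le> n"
  shows "n \<noteq> 8 \<Longrightarrow> 4 + star_bound (n - 3) \<le> turan_M n"
    and "2 + star_bound (n - 3) \<le> turan_M_slack n"
    and "11 \<le> n \<Longrightarrow> 4 + star_bound (n - 3) = turan_M n"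
proof -
  have "(n \<noteq> 8 \<longrightarrow> 4 + star_bound (n - 3) \<le> turan_M n) \<and> 2 + star_bound (n - 3) \<le> turan_M_slack n \<and>
    (11 \<le> n \<longrightarrow> 4 + star_bound (n - 3) = turan_M n)"
  proof (cases "n \<le> 10")
    case True
    then show ?thesis using nat_6_10_cases[OF assms] star_bound_large[of 0] star_bound_large[of 1] by auto
  next
    case False
    then obtain i where i: "n = 11 + i" using le_Suc_ex[of 11 n] by auto
    then have "n - 3 = 6 + (2 + i)" by simp
    then show ?thesis
      using star_bound_large[of "2 + i"] turan_M_large[of i] turan_M_slack_large[of i] i
      by (simp add: algebra_simps)
  qed
  then show "n \<noteq> 8 \<Longrightarrow> 4 + star_bound (n - 3) \<le> turan_M n" "2 + star_bound (n - 3) \<le> turan_M_slack n"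
    "11 \<le> n \<Longrightarrow> 4 + star_bound (n - 3) = turan_M n" by auto
qed

lemma double_le_turan_M_slack: "6 \<le> n \<Longrightarrow> 2 * n - 4 \<le> turan_M_slack n"
proof (cases "n \<le> 10")
  case True
  then show "6 \<le> n \<Longrightarrow> ?thesis" using nat_6_10_cases[of n] by auto
next
  case False
  then obtain i where i: "n = 11 + i" using le_Suc_ex[of 11 n] by auto
  then show ?thesis using turan_M_slack_large[of i] by simp
qed

text \<open>Here d is the number of edges through a fixed pair, whose extensions leave n - 1 - d
  vertices to the other edges. Lowering d by one frees a vertex, and beyond six vertices a new
  vertex raises \<open>star_bound\<close> by at least one, so d = 2 is the worst case.\<close>

lemma add_star_bound_le:
  assumes "2 \<le> d" "d + 6 \<le> n"
  shows "d + star_bound (n - 1 - d) \<le> turan_M_slack n"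
proof -
  have inc: "Suc (star_bound (m - 1)) \<le> star_bound m" if "7 \<le> m" for m
  proof -
    obtain k where "m = 7 + k" using \<open>7 \<le> m\<close> le_Suc_ex by blast
    then show ?thesis using star_bound_large[of k] star_bound_large[of "Suc k"] by simp
  qed
  have mono: "d + star_bound (n - 1 - d) \<le> 2 + star_bound (n - 3)" if "2 \<le> d" "d + 7 \<le> n" for d
    using that
  proof (induction d rule: dec_induct)
    case base
    then show ?case by (simp add: numeral_3_eq_3)
  next
    case (step d)
    then have "7 \<le> n - 1 - d" by linarith
    from inc[OF this] show ?case using step by simp
  qed
  show ?thesis
  \<comment> \<open>\<open>star_bound\<close> equals 10 at both 5 and 6, so the monotonicity
    argument does not reach the case of five free vertices.\<close>
  proof (cases "n = d + 6")
    case True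
    then show ?thesis using double_le_turan_M_slack[of n] assms by simp
  next
    case False
    then show ?thesis using mono[of d] four_plus_star_bound(2)[of n] assms by simp
  qed
qed

lemma turan_M_step_le:
  assumes "8 \<le> n"
  shows "(n - 6) + turan_M (n - 2) \<le> turan_M_slack n"
proof (cases "n \<le> 12")
  case True
  then have "n = 8 \<or> n = 9 \<or> n = 10 \<or> n = 11 \<or> n = 12" using assms by auto
  then show ?thesis using turan_M_slack_large[of 0] turan_M_slack_large[of 1] by auto
next
  case False
  then obtain i where i: "n = 13 + i" using le_Suc_ex[of 13 n] by auto
  then have "n = 11 + (2 + i)" "n - 2 = 11 + i" by simp_all
  then show ?thesis using turan_M_slack_large[of "2 + i"] turan_M_large[of i] by (simp add: algebra_simps)
qed

text \<open>The 8 collects e, f and at most three crossing edges of each kind; m counts the vertices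
  on edges missing e and f. One pair cannot be extended by these m vertices, which pays for
  \<open>star_bound m\<close> as long as that is at most m.\<close>

lemma two_pairs_bound_le:
  assumes "6 + m \<le> n"
  shows "8 + (n - 6 - m) + (n - 6) + star_bound m \<le> turan_M_slack n"
proof (cases "m \<le> 4")
  case True
  then have "star_bound m \<le> m" using nat_le_5_cases[of m] by auto
  then show ?thesis using double_le_turan_M_slack[of n] assms by linarith
next
  case False
  show ?thesis
  proof (cases "m = 5")
    case True
    then obtain i where i: "n = 11 + i" using assms le_Suc_ex[of 11 n] by auto
    then show ?thesis using turan_M_slack_large[of i] True by simp
  next
    case False
    with \<open>\<not> m \<le> 4\<close> obtain k where k: "m = 6 + k" using le_Suc_ex[of 6 m] by auto
    then obtain i where i: "n = 12 + k + i" using assms le_Suc_ex[of "12 + k" n] by auto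
    then have "n = 11 + (1 + k + i)" by simp
    then show ?thesis using turan_M_slack_large[of "1 + k + i"] star_bound_large[of k] k
      by (simp add: algebra_simps)
  qed
qed

section \<open>Intersecting and tight families\<close>

definition three_graph :: "'a set \<Rightarrow> 'a set set \<Rightarrow> bool" where
  "three_graph V H \<longleftrightarrow> finite V \<and> (\<forall>h\<in>H. h \<subseteq> V \<and> card h = 3)"

text \<open>For disjoint triples e and f met by a triple g, the three of them form a loose path exactly if
  g meets both in a single vertex, that is, if g sticks out of \<open>e \<union> f\<close>.\<close>
definition path_free :: "'a set set \<Rightarrow> bool" where
  "path_free H \<longleftrightarrow> (\<forall>e\<in>H. \<forall>f\<in>H. \<forall>g\<in>H.
     e \<inter> f = {} \<and> g \<inter> e \<noteq> {} \<and> g \<inter> f \<noteq> {} \<longrightarrow> g \<subseteq> e \<union> f)"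

text \<open>Three triples that pairwise share exactly one vertex form a loose triangle unless the
  shared vertex is the same for all pairs.\<close>
definition triangle_free :: "'a set set \<Rightarrow> bool" where
  "triangle_free H \<longleftrightarrow> (\<forall>e\<in>H. \<forall>f\<in>H. \<forall>g\<in>H. \<forall>x y z.
     e \<inter> f = {x} \<and> f \<inter> g = {y} \<and> g \<inter> e = {z} \<longrightarrow> x = y)"

definition pc_free :: "'a set \<Rightarrow> 'a set set \<Rightarrow> bool" where
  "pc_free V H \<longleftrightarrow> three_graph V H \<and> path_free H \<and> triangle_free H"

definition has_matching :: "'a set set \<Rightarrow> bool" where
  "has_matching H \<longleftrightarrow> (\<exists>e\<in>H. \<exists>f\<in>H. e \<inter> f = {})"

definition full_star :: "'a set \<Rightarrow> 'a \<Rightarrow> 'a set set" where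
  "full_star V c = {h. h \<subseteq> V \<and> card h = 3 \<and> c \<in> h}"

lemma path_freeD:
  "path_free H \<Longrightarrow> e \<in> H \<Longrightarrow> f \<in> H \<Longrightarrow> g \<in> H \<Longrightarrow> e \<inter> f = {} \<Longrightarrow> g \<inter> e \<noteq> {} \<Longrightarrow> g \<inter> f \<noteq> {}
   \<Longrightarrow> g \<subseteq> e \<union> f"
  unfolding path_free_def by blast

lemma triangle_freeD:
  "triangle_free H \<Longrightarrow> e \<in> H \<Longrightarrow> f \<in> H \<Longrightarrow> g \<in> H \<Longrightarrow> e \<inter> f = {x} \<Longrightarrow> f \<inter> g = {y} \<Longrightarrow> g \<inter> e = {z}
   \<Longrightarrow> x = y"
  unfolding triangle_free_def by blast

lemma three_graphD:
  assumes "three_graph V H"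
  shows "finite V" "h \<in> H \<Longrightarrow> h \<subseteq> V" "h \<in> H \<Longrightarrow> card h = 3" "h \<in> H \<Longrightarrow> finite h" "finite H"
proof -
  have "H \<subseteq> Pow V" using assms by (auto simp: three_graph_def)
  then show "finite H" using assms finite_subset by (auto simp: three_graph_def)
qed (use assms in \<open>auto simp: three_graph_def intro: finite_subset\<close>)

lemma pc_freeD:
  assumes "pc_free V H"
  shows "three_graph V H" "path_free H" "triangle_free H"
  using assms by (auto simp: pc_free_def)

lemma three_graph_subset: "three_graph V H \<Longrightarrow> H' \<subseteq> H \<Longrightarrow> V' \<subseteq> V \<Longrightarrow> (\<And>h. h \<in> H' \<Longrightarrow> h \<subseteq> V') \<Longrightarrow> three_graph V' H'"
  unfolding three_graph_def by (meson finite_subset subsetD)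

lemma pc_free_subset:
  assumes "pc_free V H" "H' \<subseteq> H" "V' \<subseteq> V" "\<And>h. h \<in> H' \<Longrightarrow> h \<subseteq> V'"
  shows "pc_free V' H'"
proof -
  have "three_graph V' H'" using assms three_graph_subset by (metis pc_free_def)
  moreover have "path_free H'" "triangle_free H'"
    using assms(1,2) unfolding pc_free_def path_free_def triangle_free_def by (meson subsetD)+
  ultimately show ?thesis by (simp add: pc_free_def)
qed

lemma card_three_graph_le: "three_graph V H \<Longrightarrow> card H \<le> card V choose 3"
proof -
  assume H: "three_graph V H"
  have "card H \<le> card {h. h \<subseteq> V \<and> card h = 3}"
    using H by (intro card_mono) (auto simp: three_graph_def)
  then show ?thesis using n_subsets[of V 3] H by (simp add: three_graph_def)
qed

lemma card_full_star:
  assumes "finite V" "c \<in> V"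
  shows "finite (full_star V c)" "card (full_star V c) = (card V - 1) choose 2"
proof -
  let ?P = "{s. s \<subseteq> V - {c} \<and> card s = 2}"
  have eq: "full_star V c = insert c ` ?P"
  proof (rule set_eqI, rule iffI)
    fix h assume "h \<in> full_star V c"
    then have h: "h \<subseteq> V" "card h = 3" "c \<in> h" by (auto simp: full_star_def)
    then have "h - {c} \<in> ?P" by auto
    moreover have "h = insert c (h - {c})" using h by auto
    ultimately show "h \<in> insert c ` ?P" by blast
  next
    fix h assume "h \<in> insert c ` ?P"
    then obtain s where s: "s \<subseteq> V - {c}" "card s = 2" "h = insert c s" by auto
    then have "finite s" using assms finite_subset[of s V] by blast
    moreover have "c \<notin> s" using s by blast
    ultimately show "h \<in> full_star V c" using s assms by (auto simp: full_star_def)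
  qed
  have "inj_on (insert c) ?P" by (rule inj_onI) blast
  then have "card (full_star V c) = card ?P" unfolding eq by (rule card_image)
  also have "\<dots> = (card V - 1) choose 2" using n_subsets[of "V - {c}" 2] assms by simp
  finally show "card (full_star V c) = (card V - 1) choose 2" .
  have "full_star V c \<subseteq> Pow V" by (auto simp: full_star_def)
  then show "finite (full_star V c)" using assms finite_subset by blast
qed

section \<open>Families in which no two triples share exactly one vertex\<close>

lemma card3_inter_cases:
  assumes "card h = 3" "card e = 3" "h \<inter> e \<noteq> {}"
  shows "h = e \<or> card (h \<inter> e) = 1 \<or> card (h \<inter> e) = 2"
proof -
  have fin: "finite h" "finite e" using assms card.infinite by fastforce+
  have "card (h \<inter> e) \<le> 3" using card_mono[OF fin(1), of "h \<inter> e"] assms by auto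
  moreover have "h = e" if "card (h \<inter> e) = 3"
    using that assms fin by (metis card_subset_eq inf_le1 inf_le2)
  moreover have "card (h \<inter> e) \<noteq> 0" using assms fin by auto
  ultimately show ?thesis by linarith
qed

text \<open>Every edge other than e is a pair of e with one outside vertex. Two pairs of a triple
  always intersect, so edges with different outside vertices must use the same pair. Hence either
  all edges lie in four vertices, or one pair carries them all, one per outside vertex.\<close>

lemma tight_component_card:
  assumes H: "three_graph V H" and tight: "\<And>h h'. h \<in> H \<Longrightarrow> h' \<in> H \<Longrightarrow> card (h \<inter> h') \<noteq> 1"
    and e: "e \<in> H" and meet: "\<And>h. h \<in> H \<Longrightarrow> h \<inter> e \<noteq> {}"
  shows "card H \<le> card (\<Union>H)"
proof -
  note H' = three_graphD[OF H]
  have fin: "finite (\<Union>H)" using H' by (metis Union_least finite_subset)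
  have shape: "\<exists>w. w \<notin> e \<and> h - e = {w} \<and> card (h \<inter> e) = 2 \<and> h = insert w (h \<inter> e)" if "h \<in> H" "h \<noteq> e" for h
  proof -
    have "card (h \<inter> e) = 2" using card3_inter_cases[of h e] H'(3) that e tight meet by metis
    then have "card (h - e) = 1" using H'(3,4)[OF that(1)] by (simp add: card_Diff_subset_Int)
    then obtain w where "h - e = {w}" using card_1_singletonE by blast
    then show ?thesis using \<open>card (h \<inter> e) = 2\<close> by blast
  qed
  show ?thesis
  proof (cases "card (\<Union>H) \<le> 4")
    case True
    have H4: "three_graph (\<Union>H) H" using H fin by (auto simp: three_graph_def)
    have "card (\<Union>H) \<ge> 3" using card_mono[OF fin, of e] e H'(3)[OF e] by auto
    then consider "card (\<Union>H) = 3" | "card (\<Union>H) = 4" using True by linarith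
    then show ?thesis using card_three_graph_le[OF H4] by cases (simp_all add: eval_nat_numeral)
  next
    case False
    have pair_eq: "h \<inter> e = h' \<inter> e" if hyp: "h \<in> H" "h' \<in> H" "h \<noteq> e" "h' \<noteq> e" "h - e \<noteq> h' - e" for h h'
    proof -
      obtain w w' where w: "h - e = {w}" "card (h \<inter> e) = 2" "h' - e = {w'}" "card (h' \<inter> e) = 2"
        using shape[OF hyp(1,3)] shape[OF hyp(2,4)] by blast
      then have "h \<inter> h' = (h \<inter> e) \<inter> (h' \<inter> e)" using hyp(5) by auto
      have "h \<inter> h' \<noteq> {}"
      proof
        assume "h \<inter> h' = {}"
        then have "card ((h \<inter> e) \<union> (h' \<inter> e)) = 4"
          using w H'(4)[OF hyp(1)] H'(4)[OF hyp(2)] by (subst card_Un_disjoint) auto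
        moreover have "card ((h \<inter> e) \<union> (h' \<inter> e)) \<le> card e" using H'(4)[OF e] by (intro card_mono) auto
        ultimately show False using H'(3)[OF e] by simp
      qed
      moreover have "h \<noteq> h'" using hyp by auto
      ultimately have "card (h \<inter> h') = 2"
        using card3_inter_cases[of h h'] tight H'(3) hyp by metis
      then have "card ((h \<inter> e) \<inter> (h' \<inter> e)) = 2" using \<open>h \<inter> h' = _\<close> by simp
      then have "(h \<inter> e) \<inter> (h' \<inter> e) = h \<inter> e" "(h \<inter> e) \<inter> (h' \<inter> e) = h' \<inter> e"
        using w H'(4)[OF hyp(1)] H'(4)[OF hyp(2)] by (metis card_subset_eq finite_Int inf_le1 inf_le2)+
      then show ?thesis by simp
    qed
    have big: "\<not> \<Union>H \<subseteq> insert w e" for w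
    proof
      assume "\<Union>H \<subseteq> insert w e"
      then have "card (\<Union>H) \<le> card (insert w e)" using H'(4)[OF e] by (intro card_mono) auto
      also have "\<dots> \<le> 4" using H'(3,4)[OF e] by (simp add: card_insert_if)
      finally show False using False by simp
    qed
    have other: "\<exists>h'\<in>H. h' \<noteq> e \<and> h' - e \<noteq> h - e" if hyp: "h \<in> H" "h \<noteq> e" for h
    proof (rule ccontr)
      assume no: "\<not> ?thesis"
      obtain w where "h - e = {w}" using shape[OF hyp] by blast
      then have "\<Union>H \<subseteq> insert w e" using no by blast
      then show False using big by blast
    qed
    have same: "h \<inter> e = h' \<inter> e" if hyp: "h \<in> H" "h' \<in> H" "h \<noteq> e" "h' \<noteq> e" for h h'
    proof (cases "h - e = h' - e")
      case True
      \<comment> \<open>When h and h' have the same outside vertex, a third edge with another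
        outside vertex compares their pairs.\<close>
      obtain k where k: "k \<in> H" "k \<noteq> e" "k - e \<noteq> h - e" using other[of h] hyp by blast
      then show ?thesis using pair_eq[of h k] pair_eq[of k h'] hyp True by auto
    next
      case False
      then show ?thesis using pair_eq hyp by blast
    qed
    have "inj_on (\<lambda>h. h - e) (H - {e})"
    proof (rule inj_onI)
      fix h h' assume "h \<in> H - {e}" "h' \<in> H - {e}" "h - e = h' - e"
      then show "h = h'" using same[of h h'] by blast
    qed
    then have "card (H - {e}) = card ((\<lambda>h. h - e) ` (H - {e}))" by (simp add: card_image)
    also have "\<dots> \<le> card ((\<lambda>w. {w}) ` (\<Union>H - e))"
    proof (intro card_mono)
      show "finite ((\<lambda>w. {w}) ` (\<Union>H - e))" using fin by simp
      show "(\<lambda>h. h - e) ` (H - {e}) \<subseteq> (\<lambda>w. {w}) ` (\<Union>H - e)" using shape by fastforce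
    qed
    also have "\<dots> \<le> card (\<Union>H - e)" using fin by (intro card_image_le) auto
    also have "\<dots> = card (\<Union>H) - 3" using H'(3,4)[OF e] e by (subst card_Diff_subset) auto
    finally have "card (H - {e}) \<le> card (\<Union>H) - 3" .
    then show ?thesis using e H'(5) False by simp
  qed
qed

text \<open>The edges meeting e are vertex-disjoint from those missing e: an edge with two vertices
  in e has no room for two more in an edge missing e. The bounds of the two sides therefore add
  up.\<close>

lemma tight_card_le:
  assumes "three_graph V H" and "\<And>h h'. h \<in> H \<Longrightarrow> h' \<in> H \<Longrightarrow> card (h \<inter> h') \<noteq> 1"
  shows "card H \<le> card V"
  using assms
proof (induction "card H" arbitrary: V H rule: less_induct)
  case less
  note H' = three_graphD[OF less.prems(1)]
  show ?case
  proof (cases "H = {}")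
    case False
    then obtain e where e: "e \<in> H" by blast
    let ?Q = "{h \<in> H. h \<inter> e \<noteq> {}}" and ?R = "{h \<in> H. h \<inter> e = {}}"
    have ee: "e \<inter> e \<noteq> {}" using H'(3)[OF e] by auto
    have disj: "h \<inter> h' = {}" if "h \<in> ?Q" "h' \<in> ?R" for h h'
    proof (rule ccontr)
      assume ne: "h \<inter> h' \<noteq> {}"
      have hh: "h \<in> H" "h' \<in> H" "h \<inter> e \<noteq> {}" "h' \<inter> e = {}" using that by auto
      then have ne': "h \<noteq> h'" "h \<noteq> e" using ne by auto
      then have two: "card (h \<inter> e) = 2" "card (h \<inter> h') = 2"
        using card3_inter_cases[of h e] card3_inter_cases[of h h'] H'(3) hh e less.prems(2) ne by metis+
      have "card ((h \<inter> e) \<union> (h \<inter> h')) = 4"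
        using two hh(4) H'(4)[OF hh(1)] by (subst card_Un_disjoint) auto
      moreover have "card ((h \<inter> e) \<union> (h \<inter> h')) \<le> card h" using H'(4)[OF hh(1)] by (intro card_mono) auto
      ultimately show False using H'(3)[OF hh(1)] by simp
    qed
    have QV: "\<Union>?Q \<subseteq> V" using H'(2) by blast
    have "three_graph V ?Q" using less.prems(1) by (auto simp: three_graph_def)
    then have Q: "card ?Q \<le> card (\<Union>?Q)"
      by (rule tight_component_card[of _ _ e]) (use less.prems(2) e ee in auto)
    have R3: "three_graph (V - \<Union>?Q) ?R"
      using disj H'(2) by (intro three_graph_subset[OF less.prems(1)]) blast+
    have "?R \<subset> H" using e ee by blast
    then have "card ?R < card H" using H'(5) psubset_card_mono by blast
    then have R: "card ?R \<le> card (V - \<Union>?Q)" by (rule less.hyps[OF _ R3]) (use less.prems(2) in auto)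
    have "?Q \<union> ?R = H" by auto
    then have "card H \<le> card ?Q + card ?R" using card_Un_le[of ?Q ?R] by (simp only:)
    also have "\<dots> \<le> card (\<Union>?Q) + card (V - \<Union>?Q)" using Q R by simp
    also have "\<dots> = card V"
      using card_Diff_subset[OF finite_subset[OF QV H'(1)] QV] card_mono[OF H'(1) QV] by linarith
    finally show ?thesis .
  qed simp
qed

section \<open>Intersecting triangle-free families\<close>

lemma card3_insert:
  assumes "card h = 3" "a \<in> h" "b \<in> h" "a \<noteq> b"
  obtains t where "h = {a, b, t}" "t \<noteq> a" "t \<noteq> b"
proof -
  have "finite h" using assms card.infinite by fastforce
  then have "card (h - {a, b}) = 1" using assms by (subst card_Diff_subset) auto
  then obtain t where "h - {a, b} = {t}" using card_1_singletonE by blast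
  then show thesis using that[of t] assms by blast
qed

lemma card3_insert_two:
  assumes "card h = 3" "a \<in> h"
  obtains s t where "h = {a, s, t}" "t \<noteq> a" "t \<noteq> s" "s \<noteq> a"
proof -
  have "card (h - {a}) = 2" using assms by simp
  then obtain s t where "h - {a} = {s, t}" "s \<noteq> t" by (auto simp: card_2_iff)
  then show thesis using that[of s t] assms(2) by blast
qed

lemma card2_insert:
  assumes "card h = 2" "a \<in> h"
  obtains t where "h = {a, t}" "t \<noteq> a"
  using assms by (metis card_2_iff doubleton_eq_iff insertE singletonD)

text \<open>If h met both k1 and k2 in one vertex only, the three would form a loose triangle. As y
  is missing from h, its traces on k1 and k2 are disjoint, so their sizes are 1 and 2 and nothing of
  h is left outside.\<close>

lemma intersecting_avoid_center:
  assumes H: "three_graph V H" "triangle_free H" and int: "\<forall>h\<in>H. \<forall>h'\<in>H. h \<inter> h' \<noteq> {}"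
    and k: "k1 \<in> H" "k2 \<in> H" "k1 \<inter> k2 = {y}" and h: "h \<in> H" "y \<notin> h"
  shows "h \<subseteq> k1 \<union> k2" "card (h \<inter> k1) = 2 \<and> card (h \<inter> k2) = 1 \<or> card (h \<inter> k1) = 1 \<and> card (h \<inter> k2) = 2"
proof -
  note H' = three_graphD[OF H(1)]
  have ne: "h \<noteq> k1" "h \<noteq> k2" using k h by auto
  have no: "\<not> (card (h \<inter> k1) = 1 \<and> card (h \<inter> k2) = 1)"
  proof
    assume "card (h \<inter> k1) = 1 \<and> card (h \<inter> k2) = 1"
    then obtain u v where "h \<inter> k1 = {u}" "k2 \<inter> h = {v}" by (metis card_1_singletonE inf_commute)
    then show False using triangle_freeD[OF H(2) k(1,2) h(1) k(3)] h(2) by blast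
  qed
  have c: "card (h \<inter> k1) = 1 \<or> card (h \<inter> k1) = 2" "card (h \<inter> k2) = 1 \<or> card (h \<inter> k2) = 2"
    using card3_inter_cases[of h k1] card3_inter_cases[of h k2] H'(3) k h ne int by metis+
  have "(h \<inter> k1) \<inter> (h \<inter> k2) = {}" using k(3) h(2) by auto
  then have U: "card ((h \<inter> k1) \<union> (h \<inter> k2)) = card (h \<inter> k1) + card (h \<inter> k2)"
    using H'(4)[OF h(1)] by (intro card_Un_disjoint) auto
  have le: "card ((h \<inter> k1) \<union> (h \<inter> k2)) \<le> 3"
    using card_mono[OF H'(4)[OF h(1)], of "(h \<inter> k1) \<union> (h \<inter> k2)"] H'(3)[OF h(1)] by auto
  show 2: "card (h \<inter> k1) = 2 \<and> card (h \<inter> k2) = 1 \<or> card (h \<inter> k1) = 1 \<and> card (h \<inter> k2) = 2"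
    using U le c no by linarith
  then have "card ((h \<inter> k1) \<union> (h \<inter> k2)) = card h" using U H'(3)[OF h(1)] by auto
  then have "(h \<inter> k1) \<union> (h \<inter> k2) = h" using H'(4)[OF h(1)] by (intro card_subset_eq) auto
  then show "h \<subseteq> k1 \<union> k2" by blast
qed

text \<open>If two edges meet only in y and some edge avoids y, there are edges {y, p, q}, {y, r, s}
  and {p, q, r}. On these five vertices there are at most 10 edges. An edge leaving them forces all
  edges except {y, p, q} and {p, q, r} to contain y and r, which gives at most 2 + (n - 2)
  edges.\<close>

lemma intersecting_star_or_small:
  assumes H: "three_graph V H" "triangle_free H" and int: "\<forall>h\<in>H. \<forall>h'\<in>H. h \<inter> h' \<noteq> {}"
  shows "(\<exists>c. \<forall>h\<in>H. c \<in> h) \<or> card H \<le> max 10 (card V)"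
proof (cases "\<exists>h\<in>H. \<exists>h'\<in>H. card (h \<inter> h') = 1")
  case False
  then have "card H \<le> card V" using tight_card_le[OF H(1)] by blast
  then show ?thesis by (simp add: le_max_iff_disj)
next
  case True
  note H' = three_graphD[OF H(1)]
  obtain k1 k2 y where k: "k1 \<in> H" "k2 \<in> H" "k1 \<inter> k2 = {y}"
    using True by (metis card_1_singletonE)
  note avoid = intersecting_avoid_center[OF H int]
  show ?thesis
  proof (cases "\<forall>h\<in>H. y \<in> h")
    case False
    then obtain h3 where h3: "h3 \<in> H" "y \<notin> h3" by blast
    obtain h1 h2 where h12: "h1 \<in> H" "h2 \<in> H" "h1 \<inter> h2 = {y}" "card (h3 \<inter> h1) = 2" "card (h3 \<inter> h2) = 1"
      using avoid(2)[OF k h3] k by (metis inf_commute)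
    obtain p q where pq: "h3 \<inter> h1 = {p, q}" "p \<noteq> q" using h12(4) by (metis card_2_iff)
    obtain r where r: "h3 \<inter> h2 = {r}" using h12(5) by (metis card_1_singletonE)
    have yr: "y \<in> h1" "y \<in> h2" using h12(3) by auto
    have e1: "h1 = {y, p, q}" using card3_insert[of h1 p q] pq yr(1) h3(2) H'(3)[OF h12(1)] by blast
    have e3: "h3 = {p, q, r}"
      using avoid(1)[OF h12(1,2,3) h3] pq r by blast
    obtain s where s: "h2 = {y, r, s}" "s \<noteq> y" "s \<noteq> r"
      using card3_insert[of h2 y r] yr(2) r H'(3)[OF h12(2)] h3(2) by blast
    have ynr: "y \<noteq> r" using h3(2) r by blast
    have "r \<in> h2" "p \<in> h1" "q \<in> h1" using r pq by auto
    then have r_notin: "r \<noteq> p" "r \<noteq> q" using h12(3) ynr by (metis IntI singletonD)+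
    let ?five = "{y, p, q, r, s}"
    show ?thesis
    proof (cases "\<forall>h\<in>H. h \<subseteq> ?five")
      case True
      then have "three_graph ?five H" using H'(3) by (auto simp: three_graph_def)
      then have "card H \<le> card ?five choose 3" by (rule card_three_graph_le)
      also have "\<dots> \<le> 5 choose 3" by (intro binomial_right_mono) (auto simp: card_insert_if)
      also have "\<dots> = 10" by (simp add: eval_nat_numeral)
      finally show ?thesis by (simp add: le_max_iff_disj)
    next
      case False
      have outside: "y \<in> h \<and> r \<in> h" if h: "h \<in> H" "\<not> h \<subseteq> ?five" for h
      proof -
        have y: "y \<in> h"
        proof (rule ccontr)
          assume "y \<notin> h"
          from avoid(1)[OF h12(1,2,3) h(1) this] have "h \<subseteq> ?five" unfolding e1 s by blast
          then show False using h by simp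
        qed
        \<comment> \<open>Otherwise h, h2 and h3 form a loose triangle with corners y, r and the
          vertex of h in {p, q}.\<close>
        have "r \<in> h"
        proof (rule ccontr)
          assume nr: "r \<notin> h"
          then obtain i where i: "i \<in> h" "i = p \<or> i = q" using int[rule_format, OF h(1) h3(1)] e3 by blast
          then have "i \<noteq> y" using h3(2) e3 by blast
          then obtain z where z: "h = {y, i, z}" "z \<noteq> y" "z \<noteq> i" using card3_insert[of h y i] y i H'(3)[OF h(1)] by metis
          then have zn: "z \<notin> ?five" using h(2) i(2) by blast
          have a: "h \<inter> h2 = {y}" using z s zn nr i pq r_notin e1 h12(3) by blast
          have b: "h2 \<inter> h3 = {r}" using r by blast
          have c: "h3 \<inter> h = {i}" using z e3 zn nr i h3(2) by blast
          show False using triangle_freeD[OF H(2) h(1) h12(2) h3(1) a b c] ynr by simp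
        qed
        then show ?thesis using y by simp
      qed
      obtain h0 where h0: "h0 \<in> H" "\<not> h0 \<subseteq> ?five" using False by blast
      then obtain z where z: "h0 = {y, r, z}" "z \<noteq> y" "z \<noteq> r"
        using outside[OF h0] card3_insert[of h0 y r] H'(3)[OF h0(1)] ynr by metis
      then have zn: "z \<notin> ?five" using h0(2) by blast
      have h10: "h1 \<inter> h0 = {y}" using e1 z zn r_notin ynr by blast
      have "h = h3 \<or> h = h1 \<or> (\<exists>t\<in>V - {y, r}. h = {y, r, t})" if h: "h \<in> H" for h
      proof (cases "y \<in> h")
        case False
        \<comment> \<open>The edge h lies in \<open>h1 \<union> h0\<close> and in
          \<open>h1 \<union> h2\<close>. As z is outside the five vertices, these sets share only y
          and the vertices of h3.\<close>
        have "h \<subseteq> h3" using avoid(1)[OF h12(1) h0(1) h10 h False] avoid(1)[OF h12(1,2,3) h False]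
          False e1 e3 z s zn by blast
        then have "h = h3" using H'(3,4) h h3(1) by (metis card_subset_eq)
        then show ?thesis by simp
      next
        case y: True
        show ?thesis
        proof (cases "r \<in> h")
          case True
          then obtain t where "h = {y, r, t}" "t \<noteq> y" "t \<noteq> r" using card3_insert[of h y r] y H'(3)[OF h] ynr by metis
          then show ?thesis using H'(2)[OF h] by blast
        next
          case nr: False
          have "h = h1"
          proof (rule ccontr)
            assume ne: "h \<noteq> h1"
            obtain i where i: "i \<in> h" "i = p \<or> i = q" using int[rule_format, OF h h3(1)] e3 nr by blast
            then have "i \<noteq> y" using h3(2) e3 by blast
            then obtain t where t: "h = {y, i, t}" "t \<noteq> y" "t \<noteq> i" using card3_insert[of h y i] y i H'(3)[OF h] by metis
            have "h \<subseteq> ?five" using outside[OF h] nr by blast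
            then have tz: "t \<noteq> z" using t zn by blast
            have a: "h \<inter> h0 = {y}" using t z tz nr i zn by blast
            have b: "h0 \<inter> h3 = {r}" using z e3 zn h3(2) by blast
            have "t \<notin> {p, q, r}" using t i ne e1 nr by auto
            then have c: "h3 \<inter> h = {i}" using t i e3 h3(2) by blast
            show False using triangle_freeD[OF H(2) h h0(1) h3(1) a b c] ynr by simp
          qed
          then show ?thesis by simp
        qed
      qed
      then have "H \<subseteq> {h3, h1} \<union> (\<lambda>t. {y, r, t}) ` (V - {y, r})" by blast
      then have "card H \<le> card ({h3, h1} \<union> (\<lambda>t. {y, r, t}) ` (V - {y, r}))"
        using H'(1) by (intro card_mono) auto
      also have "\<dots> \<le> card {h3, h1} + card ((\<lambda>t. {y, r, t}) ` (V - {y, r}))" by (rule card_Un_le)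
      also have "\<dots> \<le> 2 + card (V - {y, r})"
        using H'(1) by (intro add_mono card_image_le) (auto simp: card_insert_if)
      also have "\<dots> = card V"
      proof -
        have "{y, r} \<subseteq> V" using H'(2)[OF h12(2)] s by blast
        then show ?thesis using card_Diff_subset[of "{y, r}" V] card_mono[OF H'(1), of "{y, r}"] ynr by simp
      qed
      finally show ?thesis by (simp add: le_max_iff_disj)
    qed
  qed blast
qed

text \<open>From eight vertices on, the size of a full star exceeds both 10 and the number of
  vertices, so equality leaves only the star alternative.\<close>

lemma intersecting_card_le:
  assumes H: "three_graph V H" "triangle_free H" and int: "\<forall>h\<in>H. \<forall>h'\<in>H. h \<inter> h' \<noteq> {}"
  shows "card H \<le> star_bound (card V)"
    and "8 \<le> card V \<Longrightarrow> card H = star_bound (card V) \<Longrightarrow> \<exists>c\<in>V. H = full_star V c"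
proof -
  note H' = three_graphD[OF H(1)]
  have "card H \<le> star_bound (card V) \<and>
    (8 \<le> card V \<longrightarrow> card H = star_bound (card V) \<longrightarrow> (\<exists>c\<in>V. H = full_star V c))"
  proof (cases "card V \<le> 5")
    case True
    then show ?thesis using card_three_graph_le[OF H(1)] by (simp add: star_bound_def)
  next
    case False
    then obtain k where k: "card V = 6 + k" using le_Suc_ex[of 6 "card V"] by auto
    have b: "2 * star_bound (card V) = k * k + 9 * k + 20" using star_bound_large[of k] k by simp
    from intersecting_star_or_small[OF assms] show ?thesis
    proof
      assume "card H \<le> max 10 (card V)"
      moreover have "max 10 (card V) \<le> star_bound (card V)" using b k by (simp add: max_def)
      moreover have "max 10 (card V) < star_bound (card V)" if "8 \<le> card V" using b k that by (auto simp: max_def)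
      ultimately show ?thesis by linarith
    next
      assume "\<exists>c. \<forall>h\<in>H. c \<in> h"
      then obtain c where c: "\<forall>h\<in>H. c \<in> h" by blast
      show ?thesis
      proof (cases "H = {}")
        case True
        then show ?thesis using b by auto
      next
        case ne: False
        then have cV: "c \<in> V" using c H'(2) by blast
        have sub: "H \<subseteq> full_star V c" using c H' by (auto simp: full_star_def)
        have fs: "card (full_star V c) = star_bound (card V)" "finite (full_star V c)"
          using card_full_star[OF H'(1) cV] False by (simp_all add: star_bound_def)
        have "card H \<le> star_bound (card V)" using card_mono[OF fs(2) sub] fs(1) by simp
        moreover have "H = full_star V c" if "card H = star_bound (card V)"
          using that card_subset_eq[OF fs(2) sub] fs(1) by simp
        ultimately show ?thesis using cV by blast
      qed
    qed
  qed
  then show "card H \<le> star_bound (card V)"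
    and "8 \<le> card V \<Longrightarrow> card H = star_bound (card V) \<Longrightarrow> \<exists>c\<in>V. H = full_star V c" by auto
qed

section \<open>Edges crossing between two disjoint edges\<close>

definition crossing :: "'a set set \<Rightarrow> 'a set \<Rightarrow> 'a set \<Rightarrow> 'a set set" where
  "crossing H e f = {h \<in> H. card (h \<inter> e) = 2 \<and> h \<inter> f \<noteq> {}}"

lemma two_subset_of_three:
  assumes "card e = 3" "s \<subseteq> e" "card s = 2"
  obtains x where "x \<in> e" "s = e - {x}"
proof -
  have fin: "finite e" using assms card.infinite by fastforce
  then have "card (e - s) = 1" using assms by (subst card_Diff_subset) (auto intro: finite_subset)
  then obtain x where "e - s = {x}" using card_1_singletonE by blast
  then show thesis using that[of x] assms(2) by blast
qed

lemma crossing_shape: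
  assumes H: "three_graph V H" and e: "e \<inter> f = {}" and h: "h \<in> crossing H e f"
  obtains b where "b \<in> f" "h \<inter> f = {b}" "h = insert b (h \<inter> e)"
proof -
  note H' = three_graphD[OF H]
  have hH: "h \<in> H" "card (h \<inter> e) = 2" "h \<inter> f \<noteq> {}" using h by (auto simp: crossing_def)
  then have "card (h - e) = 1" using H'(3,4)[OF hH(1)] by (simp add: card_Diff_subset_Int)
  then obtain b where "h - e = {b}" using card_1_singletonE by blast
  moreover have "h \<inter> f \<subseteq> h - e" using e by blast
  ultimately have "h \<inter> f = {b}" using hH(3) by (metis subset_singletonD)
  moreover have "h = insert b (h \<inter> e)" using \<open>h - e = {b}\<close> by blast
  ultimately show thesis using that[of b] by blast
qed

text \<open>Otherwise h and h' share a single vertex of e and meet f in different vertices, so that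
  h, h' and f form a loose triangle.\<close>

lemma crossing_same:
  assumes H: "three_graph V H" "triangle_free H" and e: "e \<in> H" "f \<in> H" "e \<inter> f = {}"
    and h: "h \<in> crossing H e f" and h': "h' \<in> crossing H e f"
  shows "h \<inter> e = h' \<inter> e \<or> h \<inter> f = h' \<inter> f"
proof (rule ccontr)
  assume "\<not> ?thesis"
  then have ne: "h \<inter> e \<noteq> h' \<inter> e" "h \<inter> f \<noteq> h' \<inter> f" by auto
  note H' = three_graphD[OF H(1)]
  obtain b where b: "b \<in> f" "h \<inter> f = {b}" "h = insert b (h \<inter> e)" using crossing_shape[OF H(1) e(3) h] .
  obtain b' where b': "b' \<in> f" "h' \<inter> f = {b'}" "h' = insert b' (h' \<inter> e)" using crossing_shape[OF H(1) e(3) h'] .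
  have hH: "h \<in> H" "h' \<in> H" "card (h \<inter> e) = 2" "card (h' \<inter> e) = 2" using h h' by (auto simp: crossing_def)
  obtain x where x: "x \<in> e" "h \<inter> e = e - {x}" using two_subset_of_three[OF H'(3)[OF e(1)] _ hH(3)] by auto
  obtain x' where x': "x' \<in> e" "h' \<inter> e = e - {x'}" using two_subset_of_three[OF H'(3)[OF e(1)] _ hH(4)] by auto
  have "x \<noteq> x'" using ne x x' by auto
  then obtain t where t: "e = {x, x', t}" "t \<noteq> x" "t \<noteq> x'" using card3_insert[OF H'(3)[OF e(1)] x(1) x'(1)] by metis
  have "h \<inter> h' = (h \<inter> e) \<inter> (h' \<inter> e) \<union> ((h \<inter> f) \<inter> (h' \<inter> f))"
  proof -
    have "h = (h \<inter> e) \<union> (h \<inter> f)" "h' = (h' \<inter> e) \<union> (h' \<inter> f)" using b b' by auto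
    then show ?thesis using e(3) by blast
  qed
  moreover have "(e - {x}) \<inter> (e - {x'}) = {t}" using t \<open>x \<noteq> x'\<close> by auto
  moreover have "{b} \<inter> {b'} = {}" using ne(2) b(2) b'(2) by simp
  ultimately have "h \<inter> h' = {t}" by (simp only: x(2) x'(2) b(2) b'(2) Un_empty_right)
  moreover have "h' \<inter> f = {b'}" "f \<inter> h = {b}" using b b' by auto
  ultimately have "t = b'" using triangle_freeD[OF H(2) hH(1,2) e(2)] by blast
  then show False using t b' e(3) by blast
qed

text \<open>A crossing edge is a cell of a 3 by 3 grid, given by its pair in e and its vertex in f.
  By \<open>crossing_same\<close> any two cells share a row or a column, so all of them lie on one
  line.\<close>

lemma card_crossing_le:
  assumes H: "three_graph V H" "triangle_free H" and e: "e \<in> H" "f \<in> H" "e \<inter> f = {}"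
  shows "card (crossing H e f) \<le> 3"
proof -
  note H' = three_graphD[OF H(1)]
  note same = crossing_same[OF assms]
  have im: "card (\<phi> ` s) \<le> 3" if "s \<in> H" for \<phi> :: "'a \<Rightarrow> 'a set" and s
    using card_image_le[of s \<phi>] H'(3,4)[OF that] by simp
  have fin: "finite (\<phi> ` s)" if "s \<in> H" for \<phi> :: "'a \<Rightarrow> 'a set" and s
    using H'(4)[OF that] by simp
  show ?thesis
  proof (cases "\<exists>p. \<forall>h\<in>crossing H e f. h \<inter> e = p")
    case True
    then obtain p where p: "\<And>h. h \<in> crossing H e f \<Longrightarrow> h \<inter> e = p" by blast
    have "crossing H e f \<subseteq> (\<lambda>b. insert b p) ` f"
    proof
      fix h assume h: "h \<in> crossing H e f"
      obtain b where "b \<in> f" "h = insert b (h \<inter> e)" using crossing_shape[OF H(1) e(3) h] .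
      then show "h \<in> (\<lambda>b. insert b p) ` f" unfolding p[OF h] by blast
    qed
    then show ?thesis using card_mono[OF fin[OF e(2)]] im[OF e(2)] le_trans by blast
  next
    case False
    then obtain h h' where hh: "h \<in> crossing H e f" "h' \<in> crossing H e f" "h \<inter> e \<noteq> h' \<inter> e" by metis
    obtain b where b: "h \<inter> f = {b}" using crossing_shape[OF H(1) e(3) hh(1)] .
    have "k \<inter> f = {b}" if "k \<in> crossing H e f" for k
      using same[OF hh(1,2)] same[OF hh(1) that] same[OF hh(2) that] hh(3) b by auto
    then have "crossing H e f \<subseteq> (\<lambda>x. insert b (e - {x})) ` e"
    proof (intro subsetI)
      fix k assume bk: "\<And>k. k \<in> crossing H e f \<Longrightarrow> k \<inter> f = {b}" and k: "k \<in> crossing H e f"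
      have "k = insert b (k \<inter> e)"
      proof -
        obtain d where "k \<inter> f = {d}" "k = insert d (k \<inter> e)" using crossing_shape[OF H(1) e(3) k] .
        then show ?thesis using bk[OF k] by simp
      qed
      moreover obtain x where "x \<in> e" "k \<inter> e = e - {x}"
        using two_subset_of_three[OF H'(3)[OF e(1)], of "k \<inter> e"] k by (auto simp: crossing_def)
      ultimately show "k \<in> (\<lambda>x. insert b (e - {x})) ` e" by auto
    qed
    then show ?thesis using card_mono[OF fin[OF e(1)]] im[OF e(1)] le_trans by blast
  qed
qed

lemma crossing_cover:
  assumes H: "pc_free V H" and e: "e \<in> H" "f \<in> H" "e \<inter> f = {}"
    and h: "h \<in> H" "h \<inter> e \<noteq> {}" "h \<inter> f \<noteq> {}"
  shows "h \<in> crossing H e f \<or> h \<in> crossing H f e"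
proof -
  note H' = three_graphD[OF pc_freeD(1)[OF H]]
  have sub: "h \<subseteq> e \<union> f" using path_freeD[OF pc_freeD(2)[OF H] e(1,2) h(1) e(3) h(2,3)] .
  have "card ((h \<inter> e) \<union> (h \<inter> f)) = card (h \<inter> e) + card (h \<inter> f)"
    using e(3) H'(4)[OF h(1)] by (intro card_Un_disjoint) auto
  moreover have "(h \<inter> e) \<union> (h \<inter> f) = h" using sub by blast
  ultimately have "card (h \<inter> e) + card (h \<inter> f) = 3" using H'(3)[OF h(1)] by simp
  moreover have "card (h \<inter> e) \<noteq> 0" "card (h \<inter> f) \<noteq> 0" using h H'(4)[OF h(1)] by auto
  ultimately have "card (h \<inter> e) = 2 \<or> card (h \<inter> f) = 2" by linarith
  then show ?thesis using h by (auto simp: crossing_def)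
qed

text \<open>Apart from at most eight edges inside \<open>e \<union> f\<close>, every edge is the pair \<open>g \<inter> e\<close> plus a vertex,
  the pair \<open>q \<inter> f\<close> plus a vertex, or disjoint from \<open>e \<union> f\<close>; and the vertices of the edges of the
  last kind cannot extend \<open>g \<inter> e\<close>.\<close>
lemma meeting_crossing_card:
  assumes H: "pc_free V H" and e: "e \<in> H" "f \<in> H" "e \<inter> f = {}"
    and g: "g \<in> H" "card (g \<inter> e) = 2" "g \<inter> f \<noteq> {}"
    and q: "q \<in> H" "card (q \<inter> f) = 2" "q \<inter> e \<noteq> {}" and meet: "g \<inter> q \<inter> e \<noteq> {}"
    and IH: "\<And>T. T \<subseteq> H \<Longrightarrow> \<Union>T \<inter> (e \<union> f) = {} \<Longrightarrow> card T \<le> star_bound (card (\<Union>T))"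
  shows "card H \<le> turan_M_slack (card V)"
proof -
  note H3 = pc_freeD(1)[OF H] and pf = pc_freeD(2)[OF H]
  note H' = three_graphD[OF H3]
  define p r where "p = g \<inter> e" and "r = q \<inter> f"
  have gX: "g \<in> crossing H e f" and qX: "q \<in> crossing H f e" using g q by (auto simp: crossing_def)
  have fe: "f \<inter> e = {}" using e(3) by blast
  obtain b where b: "b \<in> f" "g \<inter> f = {b}" "g = insert b p" using crossing_shape[OF H3 e(3) gX] unfolding p_def .
  obtain a where a: "a \<in> e" "q \<inter> e = {a}" "q = insert a r" using crossing_shape[OF H3 fe qX] unfolding r_def .
  have ap: "a \<in> p" using meet a unfolding p_def by auto
  have c2: "card p = 2" "card r = 2" using g q unfolding p_def r_def by auto
  obtain a' where a': "p = {a, a'}" "a' \<noteq> a" using card2_insert[OF c2(1) ap] by blast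
  \<comment> \<open>The vertex \<open>a'\<close> yields most contradictions below: it lies on e and
    g but not on q, so neither e nor g, nor any edge containing \<open>p\<close>, can link q to a
    disjoint edge that misses \<open>a'\<close>.\<close>
  have a'e: "a' \<in> e" "a' \<notin> q" "a' \<in> g" using a' a(2) unfolding p_def by auto
  have rf: "r \<subseteq> f" and pe: "p \<subseteq> e" unfolding r_def p_def by auto
  define T where "T = {h \<in> H. h \<inter> e = {} \<and> h \<inter> f = {}}"
  let ?W = "V - (e \<union> f)"
  have only_e: "\<exists>w\<in>?W - \<Union>T. h = insert w p" if h: "h \<in> H" "h \<inter> e \<noteq> {}" "h \<inter> f = {}" "h \<noteq> e" for h
  proof -
    have ph: "p \<subseteq> h"
    proof (cases "h \<inter> g = {}")
      case True
      then have "a \<notin> h" "a' \<notin> h" using a' ap b(3) by auto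
      then have "h \<inter> q = {}" using h(3) a(3) rf by blast
      then have "e \<subseteq> h \<union> q" using path_freeD[OF pf h(1) q(1) e(1)] h(2) a(1,3) by blast
      then show ?thesis using a'e \<open>a' \<notin> h\<close> by blast
    next
      case False
      then have "g \<subseteq> h \<union> f" using path_freeD[OF pf h(1) e(2) g(1) h(3)] g(3) by blast
      then show ?thesis using e(3) unfolding p_def by blast
    qed
    obtain w where w: "h = {a, a', w}" "w \<noteq> a" "w \<noteq> a'"
      using card3_insert[of h a a'] H'(3)[OF h(1)] ph a' by (metis insert_subset)
    have "w \<notin> e"
    proof
      assume "w \<in> e"
      then have "h \<subseteq> e" using w a a'e by blast
      then show False using h(4) H'(3,4) h(1) e(1) by (metis card_subset_eq)
    qed
    moreover have "w \<notin> f" using w h(3) by blast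
    moreover have "w \<notin> \<Union>T"
    proof
      assume "w \<in> \<Union>T"
      then obtain t where t: "t \<in> T" "w \<in> t" by blast
      then have tH: "t \<in> H" "t \<inter> e = {}" "t \<inter> f = {}" by (auto simp: T_def)
      then have "t \<inter> q = {}" using tH(2,3) a(1) rf by (subst a(3)) blast
      then have "h \<subseteq> t \<union> q" using path_freeD[OF pf tH(1) q(1) h(1)] t(2) w(1) a(3) by blast
      then show False using w(1) a'e tH(2) by blast
    qed
    ultimately show ?thesis using w a' H'(2)[OF h(1)] by blast
  qed
  \<comment> \<open>The two sides are not symmetric: a lies in both \<open>p\<close> and q, but b
    need not lie in \<open>r\<close>, so here the vertices of \<open>T\<close> are not
    excluded.\<close>
  have only_f: "\<exists>w\<in>?W. h = insert w r" if h: "h \<in> H" "h \<inter> f \<noteq> {}" "h \<inter> e = {}" "h \<noteq> f" for h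
  proof -
    have a'h: "a' \<notin> h" using a'e h(3) by blast
    have rh: "r \<subseteq> h"
    proof (cases "h \<inter> q = {}")
      case True
      show ?thesis
      proof (cases "b \<in> h")
        case True
        then have "g \<inter> h \<noteq> {}" "g \<inter> q \<noteq> {}" using b(2) meet by auto
        then have "g \<subseteq> h \<union> q" by (rule path_freeD[OF pf h(1) q(1) g(1) \<open>h \<inter> q = {}\<close>])
        then show ?thesis using a'e a'h by blast
      next
        case False
        \<comment> \<open>Now f links the disjoint edges h and g. Since \<open>r\<close> misses h,
          both of its vertices would have to lie in \<open>g \<inter> f\<close>, which is a single
          vertex.\<close>
        then have hg: "h \<inter> g = {}" using False h(3) pe by (subst b(3)) blast
        then have fsub: "f \<subseteq> h \<union> g" using path_freeD[OF pf h(1) g(1) e(2)] h(2) b by blast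
        then have "r \<subseteq> {b}" using True a(3) b(2) rf by blast
        then have "card r \<le> 1" using card_mono[of "{b}" r] by simp
        then show ?thesis using c2 by simp
      qed
    next
      case False
      then have "q \<subseteq> h \<union> e" using path_freeD[OF pf h(1) e(1) q(1) h(3)] q(3) by blast
      then show ?thesis using e(3) unfolding r_def by blast
    qed
    have "card (h - r) = 1" using rh c2 H'(3,4)[OF h(1)] by (subst card_Diff_subset) (auto intro: finite_subset)
    then obtain w where "h - r = {w}" using card_1_singletonE by blast
    then have w: "h = insert w r" using rh by blast
    have "w \<notin> f"
    proof
      assume "w \<in> f"
      then have "h \<subseteq> f" using w rf by simp
      then show False using h(4) H'(3,4) h(1) e(2) by (metis card_subset_eq)
    qed
    moreover have "w \<notin> e" using w h(3) by blast
    moreover have "w \<in> V" using w H'(2)[OF h(1)] by blast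
    ultimately show ?thesis using w by blast
  qed
  let ?P = "(\<lambda>w. insert w p) ` (?W - \<Union>T)" and ?R = "(\<lambda>w. insert w r) ` ?W"
  have "H \<subseteq> {e, f} \<union> crossing H e f \<union> crossing H f e \<union> ?P \<union> ?R \<union> T"
  proof
    fix h assume h: "h \<in> H"
    consider "h \<inter> e = {}" "h \<inter> f = {}" | "h \<inter> e \<noteq> {}" "h \<inter> f \<noteq> {}"
      | "h \<inter> e \<noteq> {}" "h \<inter> f = {}" | "h \<inter> f \<noteq> {}" "h \<inter> e = {}" by blast
    then show "h \<in> {e, f} \<union> crossing H e f \<union> crossing H f e \<union> ?P \<union> ?R \<union> T"
    proof cases
      case 1 then show ?thesis using h by (simp add: T_def)
    next
      case 2 then show ?thesis using crossing_cover[OF H e h] by blast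
    next
      case 3 then show ?thesis using only_e[OF h 3] by blast
    next
      case 4 then show ?thesis using only_f[OF h 4] by blast
    qed
  qed
  moreover have finW: "finite ?W" using H'(1) by simp
  moreover have finH: "finite H" by (rule H'(5))
  moreover have "crossing H e f \<subseteq> H" "crossing H f e \<subseteq> H" "T \<subseteq> H" by (auto simp: crossing_def T_def)
  ultimately have "card H \<le> card ({e, f} \<union> crossing H e f \<union> crossing H f e \<union> ?P \<union> ?R \<union> T)"
    by (intro card_mono) (auto intro: finite_subset)
  also have "\<dots> \<le> card {e, f} + card (crossing H e f) + card (crossing H f e) + card ?P + card ?R + card T"
    by (intro order_trans[OF card_Un_le] add_mono order_refl)
  also have "\<dots> \<le> 2 + 3 + 3 + card (?W - \<Union>T) + card ?W + star_bound (card (\<Union>T))"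
  proof (intro add_mono card_image_le)
    show "card {e, f} \<le> 2" by (simp add: card_insert_if)
    show "card (crossing H e f) \<le> 3" "card (crossing H f e) \<le> 3"
      using card_crossing_le[OF H3 pc_freeD(3)[OF H]] e fe by auto
    show "card T \<le> star_bound (card (\<Union>T))" by (rule IH) (auto simp: T_def)
  qed (use finW in auto)
  also have "\<dots> \<le> turan_M_slack (card V)"
  proof -
    have "card (e \<union> f) = 6" using H'(3,4) e by (simp add: card_Un_disjoint)
    moreover have "e \<union> f \<subseteq> V" using H'(2) e by blast
    ultimately have cW: "card ?W = card V - 6" "6 \<le> card V"
      using H'(1) by (metis card_Diff_subset finite_subset, metis card_mono)
    have TW: "\<Union>T \<subseteq> ?W" using H'(2) unfolding T_def by blast
    have "card (?W - \<Union>T) = card ?W - card (\<Union>T)" "card (\<Union>T) \<le> card ?W"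
      using TW finW by (auto intro: card_Diff_subset card_mono finite_subset)
    then show ?thesis using two_pairs_bound_le[of "card (\<Union>T)" "card V"] cW by simp
  qed
  finally show ?thesis .
qed

section \<open>Comets with arbitrary centre, and crossing edges with two traces\<close>

definition comet_shape :: "'a set \<Rightarrow> 'a \<Rightarrow> 'a set \<Rightarrow> 'a set set" where
  "comet_shape V c e = {h. h \<subseteq> insert c e \<and> card h = 3} \<union> full_star (V - e) c"

definition is_comet :: "'a set \<Rightarrow> 'a set set \<Rightarrow> bool" where
  "is_comet V H \<longleftrightarrow> (\<exists>c e. e \<subseteq> V \<and> card e = 3 \<and> c \<in> V - e \<and> H = comet_shape V c e)"

lemma card_split_by:
  assumes "finite H"
  shows "card H = card {h \<in> H. P h} + card {h \<in> H. \<not> P h}"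
proof -
  have "card ({h \<in> H. P h} \<union> {h \<in> H. \<not> P h}) = card {h \<in> H. P h} + card {h \<in> H. \<not> P h}"
    using assms by (intro card_Un_disjoint) auto
  moreover have "{h \<in> H. P h} \<union> {h \<in> H. \<not> P h} = H" by auto
  ultimately show ?thesis by simp
qed

text \<open>Two different traces on e force all crossing edges through one vertex b of f. An edge
  meeting e but not f would contain both traces, hence equal e. So the edges meeting e are among the
  four triples of \<open>insert b e\<close>, the future head of the comet.\<close>

lemma two_traces_card:
  assumes H: "pc_free V H" and e: "e \<in> H" "f \<in> H" "e \<inter> f = {}"
    and g: "g \<in> crossing H e f" "g' \<in> crossing H e f" "g \<inter> e \<noteq> g' \<inter> e" and fe: "crossing H f e = {}"
    and IH: "card {h \<in> H. h \<inter> e = {}} \<le> star_bound (card V - 3)"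
    and IH': "11 \<le> card V \<Longrightarrow> card {h \<in> H. h \<inter> e = {}} = star_bound (card V - 3) \<Longrightarrow>
      \<exists>c\<in>V - e. {h \<in> H. h \<inter> e = {}} = full_star (V - e) c"
  shows "card H \<le> turan_M (card V)"
    and "11 \<le> card V \<Longrightarrow> card H = turan_M (card V) \<Longrightarrow> is_comet V H"
proof -
  note H3 = pc_freeD(1)[OF H] and pf = pc_freeD(2)[OF H]
  note H' = three_graphD[OF H3]
  note same = crossing_same[OF H3 pc_freeD(3)[OF H] e]
  let ?K = "{h \<in> H. h \<inter> e = {}}" and ?E = "{h \<in> H. h \<inter> e \<noteq> {}}"
  obtain b where b: "b \<in> f" "g \<inter> f = {b}" "g = insert b (g \<inter> e)" using crossing_shape[OF H3 e(3) g(1)] .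
  let ?Q = "{h. h \<subseteq> insert b e \<and> card h = 3}"
  have all_b: "k \<inter> f = {b}" if "k \<in> crossing H e f" for k
    using same[OF g(1,2)] same[OF g(1) that] same[OF g(2) that] g(3) b by auto
  have g'b: "g' = insert b (g' \<inter> e)"
  proof -
    obtain d where "g' \<inter> f = {d}" "g' = insert d (g' \<inter> e)" using crossing_shape[OF H3 e(3) g(2)] .
    then show ?thesis using all_b[OF g(2)] by simp
  qed
  have bV: "b \<in> V - e" using b(1) H'(2)[OF e(2)] e(3) by blast
  have gH: "g \<in> H" "g' \<in> H" "card (g \<inter> e) = 2" "card (g' \<inter> e) = 2" using g by (auto simp: crossing_def)
  have c6: "card (e \<union> f) = 6" "e \<union> f \<subseteq> V" using H'(2,3,4) e by (simp_all add: card_Un_disjoint)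
  then have n6: "6 \<le> card V" using card_mono[OF H'(1) c6(2)] by simp
  have cY: "card (V - e) = card V - 3" using H'(2,3,4)[OF e(1)] by (simp add: card_Diff_subset)
  have absorb: "k \<inter> e \<subseteq> h" if h: "h \<in> H" "h \<inter> f = {}" "h \<inter> k \<noteq> {}" and k: "k \<in> crossing H e f" for h k
  proof -
    have kH: "k \<in> H" "k \<inter> f \<noteq> {}" using k by (auto simp: crossing_def)
    have "k \<inter> h \<noteq> {}" using h(3) by blast
    then have "k \<subseteq> h \<union> f" using path_freeD[OF pf h(1) e(2) kH(1) h(2)] kH(2) by blast
    then show ?thesis using e(3) by blast
  qed
  have U: "(g \<inter> e) \<union> (g' \<inter> e) = e"
  proof -
    obtain x where x: "x \<in> e" "g \<inter> e = e - {x}" using two_subset_of_three[OF H'(3)[OF e(1)] _ gH(3)] by auto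
    obtain x' where x': "x' \<in> e" "g' \<inter> e = e - {x'}" using two_subset_of_three[OF H'(3)[OF e(1)] _ gH(4)] by auto
    have "x \<noteq> x'" using g(3) x(2) x'(2) by auto
    then show ?thesis unfolding x(2) x'(2) using x x' by auto
  qed
  have ne: "(g \<inter> e) \<inter> (g' \<inter> e) \<noteq> {}"
  proof
    assume "(g \<inter> e) \<inter> (g' \<inter> e) = {}"
    then have "card e = 4" using U gH H'(4)[OF e(1)] card_Un_disjoint[of "g \<inter> e" "g' \<inter> e"] by auto
    then show False using H'(3)[OF e(1)] by simp
  qed
  have E_sub: "?E \<subseteq> insert e (crossing H e f)"
  proof
    fix h assume "h \<in> ?E"
    then have h: "h \<in> H" "h \<inter> e \<noteq> {}" by auto
    show "h \<in> insert e (crossing H e f)"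
    proof (cases "h \<inter> f = {}")
      case False
      then show ?thesis using crossing_cover[OF H e h] fe by blast
    next
      case True
      consider "h \<inter> g \<noteq> {}" | "h \<inter> g' \<noteq> {}" using h(2) U by blast
      then have "e \<subseteq> h"
      proof cases
        case 1
        then have "g \<inter> e \<subseteq> h" using absorb[OF h(1) True _ g(1)] by blast
        moreover from this have "h \<inter> g' \<noteq> {}" using ne by blast
        then have "g' \<inter> e \<subseteq> h" using absorb[OF h(1) True _ g(2)] by blast
        ultimately show ?thesis using U by blast
      next
        case 2
        then have "g' \<inter> e \<subseteq> h" using absorb[OF h(1) True _ g(2)] by blast
        moreover from this have "h \<inter> g \<noteq> {}" using ne by blast
        then have "g \<inter> e \<subseteq> h" using absorb[OF h(1) True _ g(1)] by blast
        ultimately show ?thesis using U by blast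
      qed
      then have "e = h" using H'(3,4) h(1) e(1) by (metis card_subset_eq)
      then show ?thesis by simp
    qed
  qed
  have fX: "finite (crossing H e f)" using H'(5) by (simp add: crossing_def)
  have cX: "card (crossing H e f) \<le> 3" by (rule card_crossing_le[OF H3 pc_freeD(3)[OF H] e])
  have cE: "card ?E \<le> 4"
    using card_mono[OF _ E_sub] fX cX card_insert_le_m1[of 4 "crossing H e f" e] by simp
  have cQ: "card ?Q = 4" "finite ?Q"
  proof -
    have fin: "finite (insert b e)" "card (insert b e) = 4" using H'(3,4)[OF e(1)] bV by auto
    then show "card ?Q = 4" using n_subsets[OF fin(1), of 3] by (simp add: eval_nat_numeral)
    show "finite ?Q" using fin(1) by simp
  qed
  have EQ: "?E \<subseteq> ?Q"
  proof
    fix h assume h: "h \<in> ?E"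
    then consider "h = e" | "h \<in> crossing H e f" using E_sub by blast
    then show "h \<in> ?Q"
    proof cases
      case 1 then show ?thesis using H'(3)[OF e(1)] by auto
    next
      case 2
      then obtain d where "h \<inter> f = {d}" "h = insert d (h \<inter> e)" using crossing_shape[OF H3 e(3)] by metis
      then have "h = insert b (h \<inter> e)" using all_b[OF 2] by simp
      then show ?thesis using h H'(3) by blast
    qed
  qed
  have split: "card H = card ?K + card ?E" using card_split_by[OF H'(5), of "\<lambda>h. h \<inter> e = {}"] by simp
  \<comment> \<open>The edges g and h' are disjoint and h links them, meeting g in b alone.\<close>
  have shift: "h - {b} \<subseteq> h'" if h: "h \<in> ?K" "b \<in> h" and h': "h' \<in> ?K" "b \<notin> h'" and m: "h \<inter> h' \<noteq> {}" for h h'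
  proof -
    have "h' \<inter> g = {}" using h' by (subst b(3)) blast
    moreover have "h \<inter> g \<noteq> {}" using h(2) b(2) by auto
    ultimately have "h \<subseteq> h' \<union> g" using path_freeD[OF pf _ gH(1)] h h' m by blast
    moreover have "h \<inter> g \<subseteq> {b}" using h by (subst b(3)) blast
    ultimately show ?thesis by blast
  qed
  show "card H \<le> turan_M (card V)"
  proof (cases "card V = 8")
    case False
    then show ?thesis using split IH cE four_plus_star_bound(1)[OF n6 False] by linarith
  next
    case True
    let ?Y = "V - e"
    have Y5: "card ?Y = 5" "finite ?Y" using True cY H'(1) by auto
    \<comment> \<open>Eight suffices, as 4 + 8 = 12. If all edges of \<open>?K\<close> contain b,
      there are at most six. Otherwise an edge avoiding b meets every edge of \<open>?K\<close>
      through b, as only five vertices are left; by \<open>shift\<close> at most three edges contain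
      b, and at most four avoid it.\<close>
    have "card ?K \<le> 8"
    proof (cases "\<forall>h\<in>?K. b \<in> h")
      case True
      then have "?K \<subseteq> full_star ?Y b" using H' by (auto simp: full_star_def)
      then have "card ?K \<le> 4 choose 2" using card_full_star[OF Y5(2) bV] card_mono Y5 by fastforce
      then show ?thesis by (simp add: eval_nat_numeral)
    next
      case False
      then obtain h' where h': "h' \<in> ?K" "b \<notin> h'" by blast
      then have h'': "card h' = 3" "finite h'" "h' \<subseteq> ?Y" using H' by auto
      have "?K \<subseteq> {h. h \<subseteq> ?Y - {b} \<and> card h = 3} \<union> full_star (insert b h') b"
      proof
        fix h assume h: "h \<in> ?K"
        then have hh: "card h = 3" "finite h" "h \<subseteq> ?Y" using H' by auto
        show "h \<in> {h. h \<subseteq> ?Y - {b} \<and> card h = 3} \<union> full_star (insert b h') b"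
        proof (cases "b \<in> h")
          case True
          have "h \<inter> h' \<noteq> {}"
          proof
            assume "h \<inter> h' = {}"
            then have "card (h \<union> h') = 6" using hh h'' by (simp add: card_Un_disjoint)
            moreover have "card (h \<union> h') \<le> card ?Y" using hh h'' by (intro card_mono Y5) auto
            ultimately show False using Y5 by simp
          qed
          from shift[OF h True h' this] have "h \<subseteq> insert b h'" by blast
          then show ?thesis using hh True by (simp add: full_star_def)
        next
          case False
          then show ?thesis using hh by blast
        qed
      qed
      moreover have "finite {h. h \<subseteq> ?Y - {b} \<and> card h = 3}" using Y5 by simp
      moreover have fs: "finite (full_star (insert b h') b)" "card (full_star (insert b h') b) = 3 choose 2"
        using card_full_star[of "insert b h'" b] h'' h'(2) by auto
      ultimately have "card ?K \<le> card ({h. h \<subseteq> ?Y - {b} \<and> card h = 3} \<union> full_star (insert b h') b)"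
        by (intro card_mono) auto
      also have "\<dots> \<le> card {h. h \<subseteq> ?Y - {b} \<and> card h = 3} + card (full_star (insert b h') b)"
        by (rule card_Un_le)
      also have "\<dots> = (4 choose 3) + (3 choose 2)" using n_subsets[of "?Y - {b}" 3] fs Y5 bV by simp
      finally show ?thesis by (simp add: eval_nat_numeral)
    qed
    then show ?thesis using split cE True by simp
  qed
  show "is_comet V H" if n: "11 \<le> card V" and eq: "card H = turan_M (card V)"
  proof -
    have "card ?K = star_bound (card V - 3)" "card ?E = 4"
      using split eq IH cE four_plus_star_bound(3)[OF n6 n] by linarith+
    then obtain c where c: "c \<in> V - e" "?K = full_star (V - e) c" using IH'[OF n] by blast
    have EQ': "?E = ?Q" by (rule card_subset_eq[OF cQ(2) EQ]) (simp only: cQ(1) \<open>card ?E = 4\<close>)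
    \<comment> \<open>For another centre c, \<open>shift\<close> applied to {b, c, u} and {c, v, w}
      would put u into {c, v, w}. The vertices u, v, w exist because \<open>V - e\<close> has at
      least eight elements.\<close>
    have "c = b"
    proof (rule ccontr)
      assume cb: "c \<noteq> b"
      have pick: "\<exists>u. u \<in> V - e \<and> u \<notin> set xs" if "length xs \<le> 4" for xs
      proof (rule ccontr)
        assume "\<not> ?thesis"
        then have "V - e \<subseteq> set xs" by blast
        then have "card (V - e) \<le> length xs" using card_mono[OF finite_set] card_length le_trans by blast
        then show False using cY n that by simp
      qed
      obtain u where u: "u \<in> V - e" "u \<notin> {b, c}" using pick[of "[b, c]"] by auto
      obtain v where v: "v \<in> V - e" "v \<notin> {b, c, u}" using pick[of "[b, c, u]"] by auto
      obtain w where w: "w \<in> V - e" "w \<notin> {b, c, u, v}" using pick[of "[b, c, u, v]"] by auto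
      have "{b, c, u} \<in> ?K" "{c, v, w} \<in> ?K" unfolding c(2) full_star_def using u v w c(1) bV cb by auto
      from shift[OF this(1) _ this(2)] show False using cb u v w by auto
    qed
    have "H = ?E \<union> ?K" by auto
    also have "\<dots> = comet_shape V b e" unfolding comet_shape_def EQ' c(2) \<open>c = b\<close> ..
    finally have "H = comet_shape V b e" .
    then show ?thesis unfolding is_comet_def using bV H'(2,3)[OF e(1)] by blast
  qed
qed

text \<open>If two edges avoiding p meet only in y, then no third vertex of them extends p to an edge.
  This makes all extensions of p other than y isolated among the edges avoiding p, unless these
  contain a matching (induction) or never meet in a single vertex (then they are at most \<open>|V|\<close>).\<close>
lemma pair_module_card:
  fixes V :: "'a set"
  assumes H: "pc_free V H" and p: "card p = 2" and module: "\<And>h. h \<in> H \<Longrightarrow> h \<inter> p = {} \<or> p \<subseteq> h"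
    and x: "insert x1 p \<in> H" "insert x2 p \<in> H" "x1 \<noteq> x2" and n: "6 \<le> card V"
    and IH: "\<And>(V' :: 'a set) K. pc_free V' K \<Longrightarrow> card V' < card V \<Longrightarrow> has_matching K \<Longrightarrow> card K \<le> turan_M (card V')"
  shows "card H \<le> turan_M_slack (card V)"
proof -
  note H3 = pc_freeD(1)[OF H] and pf = pc_freeD(2)[OF H]
  note H' = three_graphD[OF H3]
  define Y where "Y = V - p"
  define N where "N = {x \<in> Y. insert x p \<in> H}"
  define K where "K = {h \<in> H. h \<inter> p = {}}"
  have finp: "finite p" using p card.infinite by fastforce
  have notin: "x \<notin> p" if "insert x p \<in> H" for x
    using H'(3)[OF that] p by (auto simp: insert_absorb)
  have pV: "p \<subseteq> V" using H'(2)[OF x(1)] by blast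
  have cY: "card Y = card V - 2" "finite Y" unfolding Y_def using p pV finp H'(1) by (simp_all add: card_Diff_subset)
  have finN: "finite N" "N \<subseteq> Y" using cY by (auto simp: N_def)
  have "{x1, x2} \<subseteq> N" using x notin H'(2) by (auto simp: N_def Y_def)
  then have d2: "2 \<le> card N" using card_mono[OF finN(1), of "{x1, x2}"] x(3) by simp
  have dY: "card N \<le> card V - 2" using card_mono[OF cY(2) finN(2)] cY by simp
  have KY: "h \<subseteq> Y" if "h \<in> K" for h using that H'(2) by (auto simp: K_def Y_def)
  have pcK: "pc_free Y K" by (rule pc_free_subset[OF H]) (use KY in \<open>auto simp: K_def Y_def\<close>)
  have KH: "h \<in> H" "h \<inter> p = {}" if "h \<in> K" for h using that by (auto simp: K_def)
  have K3: "card h = 3" "finite h" if "h \<in> K" for h using KH[OF that] H' by auto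
  have cH: "card H \<le> card K + card N"
  proof -
    have "H \<subseteq> K \<union> (\<lambda>x. insert x p) ` N"
    proof
      fix h assume h: "h \<in> H"
      show "h \<in> K \<union> (\<lambda>x. insert x p) ` N"
      proof (cases "h \<inter> p = {}")
        case False
        then have ph: "p \<subseteq> h" using module[OF h] by blast
        then have "card (h - p) = 1" using p finp H'(3)[OF h] by (simp add: card_Diff_subset)
        then obtain y where y: "h - p = {y}" using card_1_singletonE by blast
        then have "h = insert y p" using ph by blast
        moreover have "y \<in> Y" using y H'(2)[OF h] by (auto simp: Y_def)
        ultimately show ?thesis using h by (auto simp: N_def)
      qed (use h in \<open>simp add: K_def\<close>)
    qed
    moreover have "finite K" using H'(5) by (simp add: K_def)
    ultimately have "card H \<le> card (K \<union> (\<lambda>x. insert x p) ` N)" using finN by (intro card_mono) auto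
    also have "\<dots> \<le> card K + card ((\<lambda>x. insert x p) ` N)" by (rule card_Un_le)
    also have "\<dots> \<le> card K + card N" using finN by (simp add: card_image_le)
    finally show ?thesis .
  qed
  have attach: "x = y" if h: "h1 \<in> K" "h2 \<in> K" "h1 \<inter> h2 = {y}" and xN: "x \<in> N" and xh: "x \<in> h1" for h1 h2 x y
  proof (rule ccontr)
    assume ne: "x \<noteq> y"
    have e: "insert x p \<in> H" using xN by (simp add: N_def)
    have "x \<notin> h2" using h(3) xh ne by auto
    then have d: "insert x p \<inter> h2 = {}" using KH(2)[OF h(2)] by blast
    have "h1 \<inter> insert x p \<noteq> {}" "h1 \<inter> h2 \<noteq> {}" using xh h(3) by auto
    then have "h1 \<subseteq> insert x p \<union> h2" by (rule path_freeD[OF pf e KH(1)[OF h(2)] KH(1)[OF h(1)] d])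
    then have "h1 \<subseteq> {x} \<union> (h1 \<inter> h2)" using KH(2)[OF h(1)] by blast
    then have "h1 \<subseteq> {x, y}" using h(3) by auto
    then have "card h1 \<le> 2" using card_mono[of "{x, y}" h1] by (simp add: card_insert_if split: if_splits)
    then show False using K3[OF h(1)] by simp
  qed
  show ?thesis
  proof (cases "\<exists>h\<in>K. \<exists>h'\<in>K. card (h \<inter> h') = 1")
    case False
    \<comment> \<open>At most n - 2 edges contain \<open>p\<close> and at most n - 2 avoid it: the
      same 2n - 4 as for two books.\<close>
    then have "card K \<le> card Y" using tight_card_le[OF pc_freeD(1)[OF pcK]] by blast
    then show ?thesis using cH dY cY double_le_turan_M_slack[OF n] by linarith
  next
    case True
    then obtain h1 h2 y where h: "h1 \<in> K" "h2 \<in> K" "h1 \<inter> h2 = {y}" by (metis card_1_singletonE)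
    have h21: "h2 \<inter> h1 = {y}" using h(3) by blast
    \<comment> \<open>Of the five vertices of \<open>h1 \<union> h2\<close> only y can extend
      \<open>p\<close>, so N has at most 1 + (n - 2 - 5) elements.\<close>
    have d6: "card N + 6 \<le> card V"
    proof -
      have "card (h1 \<union> h2) + card (h1 \<inter> h2) = 6" using K3[OF h(1)] K3[OF h(2)] by (metis card_Un_Int numeral_Bit0)
      then have c5: "card (h1 \<union> h2) = 5" using h(3) by simp
      have hY: "h1 \<union> h2 \<subseteq> Y" using KY h by blast
      have "N \<subseteq> insert y (Y - (h1 \<union> h2))"
        using attach[OF h] attach[OF h(2,1) h21] finN(2) by blast
      then have "card N \<le> card (insert y (Y - (h1 \<union> h2)))" using cY by (intro card_mono) auto
      also have "\<dots> \<le> Suc (card (Y - (h1 \<union> h2)))" using cY by (simp add: card_insert_if)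
      also have "card (Y - (h1 \<union> h2)) = card Y - 5"
        using c5 hY cY finite_subset[OF hY] by (subst card_Diff_subset) auto
      finally have "card N \<le> Suc (card Y - 5)" .
      moreover have "5 \<le> card Y" using card_mono[OF cY(2) hY] c5 by simp
      ultimately show ?thesis using cY by linarith
    qed
    show ?thesis
    proof (cases "has_matching K")
      case True
      then have "card K \<le> turan_M (card V - 2)" using IH[OF pcK] cY n by simp
      then show ?thesis using cH d6 d2 turan_M_step_le[of "card V"] by linarith
    next
      case False
      then have int: "\<forall>h\<in>K. \<forall>h'\<in>K. h \<inter> h' \<noteq> {}" by (auto simp: has_matching_def)
      \<comment> \<open>An edge h of \<open>K\<close> through x would meet h1 or h2 in a single
        vertex: if y is in h, because its third vertex misses one of them; if not, by
        \<open>intersecting_avoid_center\<close>. Then \<open>attach\<close> identifies x with that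
        vertex, although x lies on neither h1 nor h2.\<close>
      have isolated: "x \<notin> h" if xN: "x \<in> N" "x \<noteq> y" and hK: "h \<in> K" for x h
      proof
        assume xh: "x \<in> h"
        have x12: "x \<notin> h1" "x \<notin> h2" using attach[OF h xN(1)] attach[OF h(2,1) h21 xN(1)] xN(2) by auto
        show False
        proof (cases "y \<in> h")
          case True
          obtain z where z: "h = {x, y, z}" "z \<noteq> x" "z \<noteq> y" using card3_insert[OF K3(1)[OF hK] xh True xN(2)] .
          have y12: "y \<in> h1" "y \<in> h2" using h(3) by auto
          have "z \<notin> h1 \<or> z \<notin> h2" using h(3) z(3) by blast
          then have "h \<inter> h1 = {y} \<or> h \<inter> h2 = {y}" using z x12 y12 by auto
          then show False using attach[OF hK h(1) _ xN(1) xh] attach[OF hK h(2) _ xN(1) xh] xN(2) by blast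
        next
          case False
          then have "card (h \<inter> h1) = 1 \<or> card (h \<inter> h2) = 1"
            using intersecting_avoid_center(2)[OF pc_freeD(1,3)[OF pcK] int h hK] by blast
          then obtain u where "h \<inter> h1 = {u} \<or> h \<inter> h2 = {u}" by (metis card_1_singletonE)
          then show False using attach[OF hK h(1) _ xN(1) xh] attach[OF hK h(2) _ xN(1) xh] x12 by blast
        qed
      qed
      \<comment> \<open>The vertex y stays, since it may extend \<open>p\<close> and still lie on
        edges of \<open>K\<close>. Hence the bound n - 1 - |N| instead of n - 2 - |N|.\<close>
      let ?V = "Y - (N - {y})"
      have "pc_free ?V K"
        by (rule pc_free_subset[OF pcK]) (use KY isolated in blast)+
      then have "card K \<le> star_bound (card ?V)"
        using intersecting_card_le(1)[of ?V K] int by (auto dest: pc_freeD)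
      also have "\<dots> \<le> star_bound (card V - 1 - card N)"
      proof (rule star_bound_mono)
        have "N - {y} \<subseteq> Y" using finN by blast
        then have "card ?V = card Y - card (N - {y})" using finN by (intro card_Diff_subset) auto
        moreover have "card N - 1 \<le> card (N - {y})" using finN by (simp add: card_Diff_singleton_if)
        ultimately show "card ?V \<le> card V - 1 - card N" using cY d2 by linarith
      qed
      finally show ?thesis using cH add_star_bound_le[OF d2 d6] by linarith
    qed
  qed
qed

section \<open>The upper bound\<close>

text \<open>The induction hypotheses enter as assumptions so that the case distinction can be used
  with e and f in either order; \<open>g0\<close> decides which of them contains two vertices of a
  crossing edge.\<close>

lemma crossing_card_le_turan_M:
  fixes V :: "'a set"
  assumes H: "pc_free V H" and e: "e \<in> H" "f \<in> H" "e \<inter> f = {}" and g0: "g0 \<in> crossing H e f"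
    and IH: "\<And>(V' :: 'a set) K. pc_free V' K \<Longrightarrow> card V' < card V \<Longrightarrow> has_matching K \<Longrightarrow> card K \<le> turan_M (card V')"
    and IHs: "\<And>(V' :: 'a set) K. pc_free V' K \<Longrightarrow> card V' < card V \<Longrightarrow> card K \<le> star_bound (card V')"
    and IHe: "\<And>(V' :: 'a set) K. pc_free V' K \<Longrightarrow> card V' < card V \<Longrightarrow> 8 \<le> card V' \<Longrightarrow>
      card K = star_bound (card V') \<Longrightarrow> \<exists>c\<in>V'. K = full_star V' c"
  shows "card H \<le> turan_M (card V) \<and> (11 \<le> card V \<longrightarrow> card H = turan_M (card V) \<longrightarrow> is_comet V H)"
proof -
  note H3 = pc_freeD(1)[OF H] and pf = pc_freeD(2)[OF H]
  note H' = three_graphD[OF H3]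
  have fe: "f \<inter> e = {}" using e(3) by blast
  have c6: "card (e \<union> f) = 6" "e \<union> f \<subseteq> V" using H'(2,3,4) e by (simp_all add: card_Un_disjoint)
  then have n6: "6 \<le> card V" using card_mono[OF H'(1) c6(2)] by simp
  have slack: ?thesis if "card H \<le> turan_M_slack (card V)"
    using that turan_M_slack_le[of "card V"] turan_M_slack_less[of "card V"] by linarith
  have T: "card T \<le> star_bound (card (\<Union>T))" if T: "T \<subseteq> H" "\<Union>T \<inter> S = {}" "S \<subseteq> V" "S \<noteq> {}" for T S
  proof (rule IHs)
    have TV: "\<Union>T \<subseteq> V" using T(1) H'(2) by blast
    show "pc_free (\<Union>T) T" by (rule pc_free_subset[OF H T(1) TV]) auto
    have "\<Union>T \<subset> V" using TV T by blast
    then show "card (\<Union>T) < card V" using H'(1) psubset_card_mono by blast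
  qed
  have efV: "e \<union> f \<subseteq> V" "e \<union> f \<noteq> {}" "f \<union> e \<subseteq> V" "f \<union> e \<noteq> {}" using c6 by auto
  have absorb: "k \<inter> e \<subseteq> h" if h: "h \<in> H" "h \<inter> f = {}" "h \<inter> k \<noteq> {}" and k: "k \<in> crossing H e f" for h k
  proof -
    have kH: "k \<in> H" "k \<inter> f \<noteq> {}" using k by (auto simp: crossing_def)
    have "k \<inter> h \<noteq> {}" using h(3) by blast
    then have "k \<subseteq> h \<union> f" using path_freeD[OF pf h(1) e(2) kH(1) h(2)] kH(2) by blast
    then show ?thesis using e(3) by blast
  qed
  define p where "p = g0 \<inter> e"
  have g0H: "g0 \<in> H" "card p = 2" "g0 \<inter> f \<noteq> {}" using g0 by (auto simp: crossing_def p_def)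
  obtain b where b: "b \<in> f" "g0 \<inter> f = {b}" "g0 = insert b p" using crossing_shape[OF H3 e(3) g0] unfolding p_def .
  obtain x where x: "x \<in> e" "p = e - {x}" using two_subset_of_three[OF H'(3)[OF e(1)] _ g0H(2)] unfolding p_def by auto
  have pair_module: "card H \<le> turan_M_slack (card V)"
    if cross: "\<And>h. h \<in> H \<Longrightarrow> h \<inter> e \<noteq> {} \<Longrightarrow> h \<inter> f \<noteq> {} \<Longrightarrow> h \<inter> p = {} \<or> p \<subseteq> h"
  proof (rule pair_module_card[OF H g0H(2)])
    show "h \<inter> p = {} \<or> p \<subseteq> h" if h: "h \<in> H" for h
    proof (cases "h \<inter> e = {} \<or> h \<inter> f \<noteq> {}")
      case True
      then show ?thesis using cross[OF h] unfolding p_def by blast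
    next
      case False
      show ?thesis
      proof (cases "h \<inter> g0 = {}")
        case True then show ?thesis unfolding p_def by blast
      next
        case False
        then show ?thesis using absorb[OF h _ False g0] \<open>\<not> (h \<inter> e = {} \<or> h \<inter> f \<noteq> {})\<close> unfolding p_def by blast
      qed
    qed
    \<comment> \<open>The two required extensions of \<open>p\<close> are e and
      \<open>g0\<close>.\<close>
    show "insert x p \<in> H" using x e(1) by (simp add: insert_absorb)
    show "insert b p \<in> H" using b(3) g0H(1) by simp
    show "x \<noteq> b" using x(1) b(1) e(3) by blast
  qed (use n6 IH in auto)
  show ?thesis
  proof (cases "\<exists>g\<in>crossing H e f. \<exists>q\<in>crossing H f e. g \<inter> q \<noteq> {}")
    case True
    then obtain g q where gq: "g \<in> crossing H e f" "q \<in> crossing H f e" "g \<inter> q \<noteq> {}" by blast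
    then have g: "g \<in> H" "card (g \<inter> e) = 2" "g \<inter> f \<noteq> {}" and q: "q \<in> H" "card (q \<inter> f) = 2" "q \<inter> e \<noteq> {}"
      by (auto simp: crossing_def)
    have "g \<inter> e \<noteq> {}" using g(2) by auto
    then have "g \<subseteq> e \<union> f" using path_freeD[OF pf e(1,2) g(1) e(3) _ g(3)] by blast
    then consider "g \<inter> q \<inter> e \<noteq> {}" | "q \<inter> g \<inter> f \<noteq> {}" using gq(3) by blast
    then show ?thesis
    proof cases
      case 1
      show ?thesis
        by (rule slack, rule meeting_crossing_card[OF H e g q 1]) (use T efV in blast)
    next
      case 2
      show ?thesis
        by (rule slack, rule meeting_crossing_card[OF H e(2,1) fe q g 2]) (use T efV in blast)
    qed
  next
    case False
    then have disj: "g \<inter> q = {}" if "g \<in> crossing H e f" "q \<in> crossing H f e" for g q using that by blast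
    show ?thesis
    proof (cases "crossing H f e = {}")
      case False
      then obtain q0 where q0: "q0 \<in> crossing H f e" by blast
      then have "q0 \<inter> e \<noteq> {}" by (auto simp: crossing_def)
      then obtain a where a: "a \<in> e" "a \<in> q0" by blast
      \<comment> \<open>Crossing edges of different kinds are disjoint here, so those with two
        vertices in e all avoid the vertex a of \<open>q0\<close> and share one pair.\<close>
      have trace: "g \<inter> e = e - {a}" if g: "g \<in> crossing H e f" for g
      proof -
        have "card (g \<inter> e) = 2" using g by (auto simp: crossing_def)
        then obtain y where "y \<in> e" "g \<inter> e = e - {y}" using two_subset_of_three[OF H'(3)[OF e(1)], of "g \<inter> e"] by auto
        moreover have "a \<notin> g" using disj[OF g q0] a(2) by blast
        ultimately show ?thesis using a(1) by blast
      qed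
      show ?thesis
      proof (rule slack, rule pair_module)
        fix h assume h: "h \<in> H" "h \<inter> e \<noteq> {}" "h \<inter> f \<noteq> {}"
        from crossing_cover[OF H e h] show "h \<inter> p = {} \<or> p \<subseteq> h"
        proof
          assume "h \<in> crossing H e f"
          then show ?thesis using trace[of h] trace[OF g0] unfolding p_def by blast
        next
          assume "h \<in> crossing H f e"
          then show ?thesis using disj[OF g0] unfolding p_def by blast
        qed
      qed
    next
      case none: True
      show ?thesis
      proof (cases "\<forall>h\<in>crossing H e f. h \<inter> e = p")
        case True
        show ?thesis
        proof (rule slack, rule pair_module)
          fix h assume h: "h \<in> H" "h \<inter> e \<noteq> {}" "h \<inter> f \<noteq> {}"
          show "h \<inter> p = {} \<or> p \<subseteq> h" using crossing_cover[OF H e h] none True by blast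
        qed
      next
        case False
        then obtain g where g: "g \<in> crossing H e f" "g0 \<inter> e \<noteq> g \<inter> e" unfolding p_def by metis
        have pcK: "pc_free (V - e) {h \<in> H. h \<inter> e = {}}"
          by (rule pc_free_subset[OF H]) (use H'(2) in blast)+
        have cY: "card (V - e) = card V - 3" using H'(2,3,4)[OF e(1)] by (simp add: card_Diff_subset)
        have lt: "card (V - e) < card V" using cY n6 by simp
        have "card {h \<in> H. h \<inter> e = {}} \<le> star_bound (card V - 3)" using IHs[OF pcK lt] cY by simp
        moreover have "\<exists>c\<in>V - e. {h \<in> H. h \<inter> e = {}} = full_star (V - e) c"
          if "11 \<le> card V" "card {h \<in> H. h \<inter> e = {}} = star_bound (card V - 3)"
          using IHe[OF pcK lt] that cY by simp
        ultimately show ?thesis using two_traces_card[OF H e g0 g none] by blast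
      qed
    qed
  qed
qed

lemma card_le_turan_M:
  fixes V :: "'a set"
  assumes "pc_free V H" "has_matching H"
  shows "card H \<le> turan_M (card V) \<and> (11 \<le> card V \<longrightarrow> card H = turan_M (card V) \<longrightarrow> is_comet V H)"
  using assms
proof (induction "card V" arbitrary: V H rule: less_induct)
  case less
  note H = less.prems(1)
  note H3 = pc_freeD(1)[OF H] and pf = pc_freeD(2)[OF H]
  note H' = three_graphD[OF H3]
  have IH: "card K \<le> turan_M (card V')" if "pc_free V' K" "card V' < card V" "has_matching K" for V' :: "'a set" and K
    using less.hyps that by blast
  have six: "6 \<le> card V'" if K: "pc_free V' K" "has_matching K" for V' :: "'a set" and K
  proof -
    note K' = three_graphD[OF pc_freeD(1)[OF K(1)]]
    obtain e f where e: "e \<in> K" "f \<in> K" "e \<inter> f = {}" using K(2) by (auto simp: has_matching_def)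
    then have "card (e \<union> f) = 6" "e \<union> f \<subseteq> V'" using K'(2,3,4) by (simp_all add: card_Un_disjoint)
    then show ?thesis using card_mono[OF K'(1)] by metis
  qed
  \<comment> \<open>With a matching, the induction hypothesis applies and lies below
    \<open>star_bound\<close>; without one the family is intersecting. Hence subgraphs that have
    lost their matching are covered too.\<close>
  have IHs: "card K \<le> star_bound (card V') \<and>
      (8 \<le> card V' \<longrightarrow> card K = star_bound (card V') \<longrightarrow> (\<exists>c\<in>V'. K = full_star V' c))"
    if K: "pc_free V' K" "card V' < card V" for V' :: "'a set" and K
  proof (cases "has_matching K")
    case True
    then show ?thesis using IH[OF K True] turan_M_le_star_bound[OF six[OF K(1) True]] by linarith
  next
    case False
    then have "\<forall>h\<in>K. \<forall>h'\<in>K. h \<inter> h' \<noteq> {}" by (auto simp: has_matching_def)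
    then show ?thesis using intersecting_card_le[OF pc_freeD(1,3)[OF K(1)]] by blast
  qed
  show ?case
  proof (cases "\<exists>e\<in>H. \<exists>f\<in>H. \<exists>g\<in>H. e \<inter> f = {} \<and> g \<inter> e \<noteq> {} \<and> g \<inter> f \<noteq> {}")
    case True
    then obtain e f g where e: "e \<in> H" "f \<in> H" "e \<inter> f = {}" and g: "g \<in> H" "g \<inter> e \<noteq> {}" "g \<inter> f \<noteq> {}"
      by blast
    have fe: "f \<inter> e = {}" using e(3) by blast
    from crossing_cover[OF H e g] show ?thesis
    proof
      assume c: "g \<in> crossing H e f"
      show ?thesis by (rule crossing_card_le_turan_M[OF H e c]) (use IH IHs in blast)+
    next
      assume c: "g \<in> crossing H f e"
      show ?thesis by (rule crossing_card_le_turan_M[OF H e(2,1) fe c]) (use IH IHs in blast)+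
    qed
  next
    case unlinked: False
    obtain e f where e: "e \<in> H" "f \<in> H" "e \<inter> f = {}" using less.prems(2) by (auto simp: has_matching_def)
    let ?Q = "{h \<in> H. h \<inter> e \<noteq> {}}" and ?R = "{h \<in> H. \<not> h \<inter> e \<noteq> {}}"
    let ?A = "\<Union>?Q"
    \<comment> \<open>A common vertex would make h meet both of the disjoint edges e and h'.\<close>
    have disj: "h \<inter> h' = {}" if "h \<in> ?Q" "h' \<in> ?R" for h h'
      using unlinked that e(1) by blast
    have AV: "?A \<subseteq> V" using H'(2) by blast
    have "e \<noteq> {}" using H'(3)[OF e(1)] by auto
    then have eA: "e \<subseteq> ?A" using e(1) by blast
    have fR: "f \<in> ?R" using e by blast
    then have fA: "f \<subseteq> V - ?A" using disj H'(2)[OF e(2)] by blast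
    have finA: "finite ?A" using AV H'(1) finite_subset by blast
    have a3: "3 \<le> card ?A" using card_mono[OF finA eA] H'(3)[OF e(1)] by simp
    have b3: "3 \<le> card (V - ?A)" using card_mono[OF _ fA] H'(1,3) e(2) by simp
    have sum: "card ?A + card (V - ?A) = card V"
      using card_Diff_subset[OF finA AV] card_mono[OF H'(1) AV] by linarith
    have "pc_free ?A ?Q" by (rule pc_free_subset[OF H]) (use AV in auto)
    then have Q: "card ?Q \<le> star_bound (card ?A)" using IHs[of ?A ?Q] sum b3 by linarith
    have "pc_free (V - ?A) ?R"
    proof (rule pc_free_subset[OF H])
      show "h \<subseteq> V - ?A" if "h \<in> ?R" for h using that disj H'(2) by blast
    qed auto
    then have R: "card ?R \<le> star_bound (card (V - ?A))" using IHs[of "V - ?A" ?R] sum a3 by linarith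
    have "card H = card ?Q + card ?R" using card_split_by[OF H'(5)] .
    then have "card H \<le> turan_M_slack (card V)" using Q R star_bound_add_le[OF a3 b3] sum by simp
    then show ?thesis using turan_M_slack_le[of "card V"] turan_M_slack_less[of "card V"] by linarith
  qed
qed

section \<open>Copies of the patterns and extremal examples\<close>

text \<open>Embeddings are given as lists whose entry i is the image of vertex i, so injectivity
  becomes \<open>distinct\<close>.\<close>

lemma contains_nthI:
  assumes "distinct xs" "\<Union>F \<subseteq> {..<length xs}" "\<And>e. e \<in> F \<Longrightarrow> (!) xs ` e \<in> E"
  shows "contains E F"
  unfolding contains_def using assms by (intro exI[of _ "(!) xs"] conjI inj_on_nth) auto

lemma contains_P3_iff:
  assumes E: "three_graph V E"
  shows "contains E P3 \<longleftrightarrow> \<not> path_free E"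
proof
  assume "contains E P3"
  then obtain f where f: "inj_on f {0,1,2,3,4,5,6::nat}" "f ` {0,1,2} \<in> E" "f ` {2,3,4} \<in> E" "f ` {4,5,6} \<in> E"
    by (auto simp: contains_def P3_def insert_commute)
  have "distinct (map f [0,1,2,3,4,5,6])" using f(1) by (simp add: distinct_map)
  then have d: "f ` {0,1,2} \<inter> f ` {4,5,6} = {}" "f ` {2,3,4} \<inter> f ` {0,1,2} \<noteq> {}" "f ` {2,3,4} \<inter> f ` {4,5,6} \<noteq> {}"
    "\<not> f ` {2,3,4} \<subseteq> f ` {0,1,2} \<union> f ` {4,5,6}"
    by (simp_all add: eq_commute)
  show "\<not> path_free E" using path_freeD[OF _ f(2,4,3) d(1-3)] d(4) by metis
next
  assume "\<not> path_free E"
  then obtain e f g where e: "e \<in> E" "f \<in> E" "g \<in> E" "e \<inter> f = {}" "g \<inter> e \<noteq> {}" "g \<inter> f \<noteq> {}" "\<not> g \<subseteq> e \<union> f"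
    by (auto simp: path_free_def)
  note c3 = three_graphD(3)[OF E]
  obtain x y z where xyz: "x \<in> g" "x \<in> e" "y \<in> g" "y \<in> f" "z \<in> g" "z \<notin> e" "z \<notin> f" using e by blast
  have "x \<noteq> y" using xyz e(4) by blast
  then obtain z' where "g = {x, y, z'}" using card3_insert[OF c3[OF e(3)] xyz(1,3)] by metis
  then have g: "g = {x, y, z}" using xyz by auto
  obtain a1 a2 where a: "e = {x, a1, a2}" "a2 \<noteq> x" "a2 \<noteq> a1" "a1 \<noteq> x"
    using card3_insert_two[OF c3[OF e(1)] xyz(2)] .
  obtain b1 b2 where b: "f = {y, b1, b2}" "b2 \<noteq> y" "b2 \<noteq> b1" "b1 \<noteq> y"
    using card3_insert_two[OF c3[OF e(2)] xyz(4)] .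
  \<comment> \<open>The list follows the path: the linking vertices x and y sit at positions 2 and
    4, and z, the vertex of g outside \<open>e \<union> f\<close>, between them.\<close>
  show "contains E P3"
  proof (rule contains_nthI[of "[a1, a2, x, z, y, b1, b2]"])
    show "distinct [a1, a2, x, z, y, b1, b2]" using a b xyz e(4) by auto
    show "\<Union>P3 \<subseteq> {..<length [a1, a2, x, z, y, b1, b2]}" by (auto simp: P3_def)
    have "{a1, a2, x} = e" "{x, z, y} = g" "{y, b1, b2} = f" using a b g by auto
    then show "(!) [a1, a2, x, z, y, b1, b2] ` h \<in> E" if "h \<in> P3" for h
      using that e(1-3) by (auto simp: P3_def)
  qed
qed

lemma contains_C3_iff:
  assumes E: "three_graph V E"
  shows "contains E C3 \<longleftrightarrow> \<not> triangle_free E"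
proof
  assume "contains E C3"
  then obtain f where f: "inj_on f {0,1,2,3,4,5::nat}" "f ` {0,5,1} \<in> E" "f ` {1,3,2} \<in> E" "f ` {2,4,0} \<in> E"
    by (auto simp: contains_def C3_def insert_commute)
  have "distinct (map f [0,1,2,3,4,5])" using f(1) by (simp add: distinct_map)
  then have d: "f ` {0,5,1} \<inter> f ` {1,3,2} = {f 1}" "f ` {1,3,2} \<inter> f ` {2,4,0} = {f 2}" "f ` {2,4,0} \<inter> f ` {0,5,1} = {f 0}"
    "f 1 \<noteq> f 2"
    by (simp_all add: eq_commute)
  show "\<not> triangle_free E" using triangle_freeD[OF _ f(2,3,4) d(1-3)] d(4) by metis
next
  assume "\<not> triangle_free E"
  then obtain e f g x y z where e: "e \<in> E" "f \<in> E" "g \<in> E"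
    and i: "e \<inter> f = {x}" "f \<inter> g = {y}" "g \<inter> e = {z}" and xy: "x \<noteq> y"
    unfolding triangle_free_def by blast
  note c3 = three_graphD(3)[OF E]
  have m: "x \<in> e" "x \<in> f" "y \<in> f" "y \<in> g" "z \<in> g" "z \<in> e" using i by auto
  \<comment> \<open>Only \<open>x \<noteq> y\<close> is given, but z = x would put x into
    \<open>f \<inter> g = {y}\<close>, and z = y would put y into
    \<open>e \<inter> f = {x}\<close>.\<close>
  have ne: "x \<noteq> z" "y \<noteq> z" "x \<notin> g" "y \<notin> e" "z \<notin> f" using i m xy by auto
  obtain s where s: "e = {x, z, s}" "s \<noteq> x" "s \<noteq> z" using card3_insert[OF c3[OF e(1)] m(1,6) ne(1)] .
  obtain t where t: "f = {x, y, t}" "t \<noteq> x" "t \<noteq> y" using card3_insert[OF c3[OF e(2)] m(2,3) xy] .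
  obtain u where u: "g = {y, z, u}" "u \<noteq> y" "u \<noteq> z" using card3_insert[OF c3[OF e(3)] m(4,5) ne(2)] .
  show "contains E C3"
  proof (rule contains_nthI[of "[z, x, y, t, u, s]"])
    have stu: "s \<in> e" "t \<in> f" "u \<in> g" using s t u by auto
    then have "s \<noteq> t" "t \<noteq> u" "s \<noteq> u" using i s(2) t(3) u(3) by (metis IntI singletonD)+
    moreover have "t \<noteq> z" "s \<noteq> y" "u \<noteq> x" using stu ne by auto
    ultimately show "distinct [z, x, y, t, u, s]" using s t u ne xy by auto
    show "\<Union>C3 \<subseteq> {..<length [z, x, y, t, u, s]}" by (auto simp: C3_def)
    have "{z, s, x} = e" "{x, t, y} = f" "{y, u, z} = g" using s t u by auto
    then show "(!) [z, x, y, t, u, s] ` h \<in> E" if "h \<in> C3" for h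
      using that e by (auto simp: C3_def)
  qed
qed

lemma contains_M2_iff:
  assumes E: "three_graph V E"
  shows "contains E M2 \<longleftrightarrow> has_matching E"
proof
  assume "contains E M2"
  then obtain f where f: "inj_on f {0,1,2,3,4,5::nat}" "f ` {0,1,2} \<in> E" "f ` {3,4,5} \<in> E"
    by (auto simp: contains_def M2_def insert_commute)
  have "distinct (map f [0,1,2,3,4,5])" using f(1) by (simp add: distinct_map)
  then have "f ` {0,1,2} \<inter> f ` {3,4,5} = {}" by (simp add: eq_commute)
  then show "has_matching E" using f(2,3) unfolding has_matching_def by blast
next
  assume "has_matching E"
  then obtain e f where e: "e \<in> E" "f \<in> E" "e \<inter> f = {}" by (auto simp: has_matching_def)
  obtain a b c where a: "e = {a, b, c}" "a \<noteq> b" "a \<noteq> c" "b \<noteq> c"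
    using three_graphD(3)[OF E e(1)] by (auto simp: card_3_iff)
  obtain u v w where u: "f = {u, v, w}" "u \<noteq> v" "u \<noteq> w" "v \<noteq> w"
    using three_graphD(3)[OF E e(2)] by (auto simp: card_3_iff)
  show "contains E M2"
  proof (rule contains_nthI[of "[a, b, c, u, v, w]"])
    show "distinct [a, b, c, u, v, w]" using a u e(3) by auto
    show "\<Union>M2 \<subseteq> {..<length [a, b, c, u, v, w]}" by (auto simp: M2_def)
    show "(!) [a, b, c, u, v, w] ` h \<in> E" if "h \<in> M2" for h
      using that e a(1) u(1) by (auto simp: M2_def)
  qed
qed

lemma admissible_iff: "admissible n E \<longleftrightarrow> pc_free {0..<n} E \<and> has_matching E"
proof -
  have "hypergraph3 n E \<longleftrightarrow> three_graph {0..<n} E" by (auto simp: hypergraph3_def three_graph_def)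
  then show ?thesis
    unfolding admissible_def pc_free_def using contains_P3_iff contains_C3_iff contains_M2_iff by blast
qed

lemma ex3_eqI:
  assumes "\<And>E. admissible n E \<Longrightarrow> card E \<le> m" "admissible n E0" "m \<le> card E0"
  shows "ex3 n = m"
  unfolding ex3_def
proof (rule Max_eqI)
  have "{card E |E. admissible n E} \<subseteq> {..m}" using assms(1) by auto
  then show "finite {card E |E. admissible n E}" by (rule finite_subset) simp
  have "m = card E0" using assms(1)[OF assms(2)] assms(3) by simp
  then show "m \<in> {card E |E. admissible n E}" using assms(2) by blast
qed (use assms(1) in auto)

section \<open>Two books and two cliques: lower bounds for small n\<close>

definition two_books :: "nat \<Rightarrow> nat set set" where
  "two_books n = {h. h \<subseteq> {0..<n} \<and> card h = 3 \<and> ({0,1} \<subseteq> h \<or> {2,3} \<subseteq> h)}"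

lemma two_books_admissible:
  assumes "6 \<le> n"
  shows "admissible n (two_books n)" "2 * n - 4 \<le> card (two_books n)"
proof -
  have shape: "\<exists>w. h = {0, 1, w} \<or> h = {2, 3, w}" if "h \<in> two_books n" for h
  proof -
    have h: "card h = 3" "{0,1} \<subseteq> h \<or> {2,3} \<subseteq> h" using that by (auto simp: two_books_def)
    from h(2) show ?thesis
    proof
      assume "{0,1} \<subseteq> h"
      then show ?thesis using card3_insert[OF h(1), of 0 1] by (metis insert_subset zero_neq_one)
    next
      assume "{2,3} \<subseteq> h"
      moreover have "(2::nat) \<noteq> 3" by simp
      ultimately show ?thesis using card3_insert[OF h(1), of 2 3] by (metis insert_subset)
    qed
  qed
  have "three_graph {0..<n} (two_books n)" by (auto simp: two_books_def three_graph_def)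
  moreover have "path_free (two_books n)"
    unfolding path_free_def
  proof (intro ballI impI, elim conjE)
    fix e f g assume h: "e \<in> two_books n" "f \<in> two_books n" "g \<in> two_books n"
      "e \<inter> f = {}" "g \<inter> e \<noteq> {}" "g \<inter> f \<noteq> {}"
    obtain s w where s: "s = {0, 1} \<or> s = {2, 3}" "g = insert w s" using shape[OF h(3)] by (metis insert_commute)
    \<comment> \<open>Disjoint edges have different spines, so one of them contains the spine of g.
      The third vertex of g then lies in the other edge, which g also meets.\<close>
    have "{0, 1} \<subseteq> e \<and> {2, 3} \<subseteq> f \<or> {2, 3} \<subseteq> e \<and> {0, 1} \<subseteq> f"
      using h(1,2,4) unfolding two_books_def by blast
    then have "s \<subseteq> e \<or> s \<subseteq> f" using s(1) by blast
    then show "g \<subseteq> e \<union> f"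
    proof
      assume "s \<subseteq> e"
      moreover from this have "w \<in> f" using h(4,6) s(2) by blast
      ultimately show ?thesis using s(2) by blast
    next
      assume "s \<subseteq> f"
      moreover from this have "w \<in> e" using h(4,5) s(2) by blast
      ultimately show ?thesis using s(2) by blast
    qed
  qed
  moreover have "triangle_free (two_books n)"
    unfolding triangle_free_def
  proof (intro ballI allI impI, elim conjE)
    fix e f g x y z assume h: "e \<in> two_books n" "f \<in> two_books n" "g \<in> two_books n"
      "e \<inter> f = {x}" "f \<inter> g = {y}" "g \<inter> e = {z}"
    obtain p q :: "nat set" where pq: "p = {0, 1}" "q = {2, 3}" by blast
    have large: "\<not> s \<subseteq> {v}" if "s = p \<or> s = q" for s v
    proof
      have "card s = 2" using that pq by (elim disjE) simp_all
      moreover assume "s \<subseteq> {v}"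
      then have "card s \<le> 1" using card_mono[of "{v}" s] by simp
      ultimately show False by simp
    qed
    have "p \<subseteq> e \<or> q \<subseteq> e" "p \<subseteq> f \<or> q \<subseteq> f" "p \<subseteq> g \<or> q \<subseteq> g"
      using h(1-3) unfolding two_books_def pq by simp_all
    \<comment> \<open>Two of three edges share a spine and so meet in at least two vertices.\<close>
    then have "p \<subseteq> e \<inter> f \<or> q \<subseteq> e \<inter> f \<or> p \<subseteq> f \<inter> g \<or> q \<subseteq> f \<inter> g \<or> p \<subseteq> g \<inter> e \<or> q \<subseteq> g \<inter> e"
      by blast
    then show "x = y" unfolding h(4-6) using large by blast
  qed
  moreover have "has_matching (two_books n)"
    unfolding has_matching_def
    by (rule bexI[of _ "{0,1,4}"], rule bexI[of _ "{2,3,5}"]) (use assms in \<open>auto simp: two_books_def\<close>)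
  ultimately show "admissible n (two_books n)" by (simp add: admissible_iff pc_free_def)
  let ?A = "(\<lambda>w. {0, 1, w}) ` ({0..<n} - {0, 1})" and ?B = "(\<lambda>w. {2, 3, w}) ` ({0..<n} - {2, 3})"
  have "inj_on (\<lambda>w. {0, 1, w}) ({0..<n} - {0, 1})" "inj_on (\<lambda>w. {2, 3, w}) ({0..<n} - {2, 3})"
    by (auto simp: inj_on_def insert_eq_iff)
  then have "card ?A = n - 2" "card ?B = n - 2" using assms by (simp_all add: card_image card_Diff_subset)
  moreover have "{0, 1, v} \<noteq> {2, 3, w}" for v w :: nat
  proof
    assume "{0, 1, v} = {2, 3, w}"
    then have "0 \<in> {2, 3, w}" "1 \<in> {2, 3, w}" by blast+
    then show False by simp
  qed
  then have "?A \<inter> ?B = {}" by blast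
  ultimately have "card (?A \<union> ?B) = 2 * n - 4" by (simp add: card_Un_disjoint)
  moreover have "?A \<union> ?B \<subseteq> two_books n" using assms by (auto simp: two_books_def)
  moreover have "finite (two_books n)" by (rule finite_subset[of _ "Pow {0..<n}"]) (auto simp: two_books_def)
  ultimately show "2 * n - 4 \<le> card (two_books n)" using card_mono[of "two_books n" "?A \<union> ?B"] by simp
qed

definition two_cliques :: "nat set set" where
  "two_cliques = {h. h \<subseteq> {0..<5} \<and> card h = 3} \<union> {h. h \<subseteq> {5..<10} \<and> card h = 3}"

lemma two_cliques_admissible:
  shows "admissible 10 two_cliques" "card two_cliques = 20"
proof -
  have block: "h \<subseteq> {0..<5} \<or> h \<subseteq> {5..<10}" if "h \<in> two_cliques" for h
    using that by (auto simp: two_cliques_def)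
  have blocks: "{0..<5} \<inter> {5..<10::nat} = {}" by auto
  have c3: "card e = 3" "finite e" if "e \<in> two_cliques" for e
    using that by (auto simp: two_cliques_def intro: finite_subset)
  have "three_graph {0..<10} two_cliques" by (fastforce simp: two_cliques_def three_graph_def)
  moreover have "path_free two_cliques"
    unfolding path_free_def
  proof (intro ballI impI, elim conjE)
    fix e f g assume h: "e \<in> two_cliques" "f \<in> two_cliques" "g \<in> two_cliques"
      "e \<inter> f = {}" "g \<inter> e \<noteq> {}" "g \<inter> f \<noteq> {}"
    \<comment> \<open>A linking edge puts e and f into the same block of five vertices, which has no
      room for two disjoint triples.\<close>
    have sub: "(e \<subseteq> {0..<5} \<and> f \<subseteq> {0..<5}) \<or> (e \<subseteq> {5..<10} \<and> f \<subseteq> {5..<10})"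
      using block[OF h(1)] block[OF h(2)] block[OF h(3)] blocks h(5,6) by blast
    have "card (e \<union> f) = 6" using c3[OF h(1)] c3[OF h(2)] h(4) by (simp add: card_Un_disjoint)
    moreover have "card (e \<union> f) \<le> 5"
    proof -
      have "card (e \<union> f) \<le> card {0..<5::nat} \<or> card (e \<union> f) \<le> card {5..<10::nat}"
        using sub by (metis card_mono finite_atLeastLessThan le_sup_iff)
      then show ?thesis by simp
    qed
    ultimately show "g \<subseteq> e \<union> f" by simp
  qed
  moreover have "triangle_free two_cliques"
    unfolding triangle_free_def
  proof (intro ballI allI impI, elim conjE)
    fix e f g x y z assume h: "e \<in> two_cliques" "f \<in> two_cliques" "g \<in> two_cliques"
      "e \<inter> f = {x}" "f \<inter> g = {y}" "g \<inter> e = {z}"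
    have "x \<in> e" "x \<in> f" "y \<in> f" "y \<in> g" using h(4,5) by auto
    then have sub: "(e \<union> f \<subseteq> {0..<5} \<and> g \<subseteq> {0..<5}) \<or> (e \<union> f \<subseteq> {5..<10} \<and> g \<subseteq> {5..<10})"
      using block[OF h(1)] block[OF h(2)] block[OF h(3)] blocks by blast
    \<comment> \<open>Two triples with one common vertex fill their block, so g is covered by its
      two one-vertex intersections with e and f.\<close>
    have "card (e \<union> f) + card (e \<inter> f) = 6" using c3[OF h(1)] c3[OF h(2)] by (metis card_Un_Int numeral_Bit0)
    then have "card (e \<union> f) = 5" using h(4) by simp
    then have full: "e \<union> f = B" if "e \<union> f \<subseteq> B" "finite B" "card B = 5" for B
      using that card_subset_eq by metis
    from sub have "g \<subseteq> e \<union> f"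
    proof
      assume B: "e \<union> f \<subseteq> {0..<5} \<and> g \<subseteq> {0..<5}"
      then show ?thesis using full[of "{0..<5}"] by simp
    next
      assume B: "e \<union> f \<subseteq> {5..<10} \<and> g \<subseteq> {5..<10}"
      then show ?thesis using full[of "{5..<10}"] by simp
    qed
    then have "g \<subseteq> (g \<inter> e) \<union> (f \<inter> g)" by blast
    then have "g \<subseteq> {z, y}" unfolding h(5,6) by blast
    then have "card g \<le> 2" using card_mono[of "{z, y}" g] by (simp add: card_insert_if split: if_splits)
    then show "x = y" using c3[OF h(3)] by simp
  qed
  moreover have "has_matching two_cliques"
    unfolding has_matching_def
    by (rule bexI[of _ "{0,1,2}"], rule bexI[of _ "{5,6,7}"]) (auto simp: two_cliques_def)
  ultimately show "admissible 10 two_cliques" by (simp add: admissible_iff pc_free_def)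
  have "card two_cliques = card {h. h \<subseteq> {0..<5::nat} \<and> card h = 3} + card {h. h \<subseteq> {5..<10::nat} \<and> card h = 3}"
    unfolding two_cliques_def
  proof (rule card_Un_disjoint)
    show "{h. h \<subseteq> {0..<5::nat} \<and> card h = 3} \<inter> {h. h \<subseteq> {5..<10} \<and> card h = 3} = {}"
    proof (rule ccontr)
      assume "\<not> ?thesis"
      then obtain h where "h \<subseteq> {0..<5::nat}" "h \<subseteq> {5..<10}" "card h = 3" by blast
      moreover from this have "h = {}" by fastforce
      ultimately show False by simp
    qed
  qed auto
  then show "card two_cliques = 20" by (simp add: n_subsets eval_nat_numeral)
qed

section \<open>Comets: admissibility, size and isomorphism\<close>

lemma comet_shape_pc_free:
  assumes V: "finite V" "e \<subseteq> V" "card e = 3" "c \<in> V - e"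
  shows "pc_free V (comet_shape V c e)"
proof -
  have fin: "finite e" using V finite_subset by blast
  have shape: "(c \<in> h \<and> h \<subseteq> V - e) \<or> h \<subseteq> insert c e" "card h = 3" "h \<subseteq> V" if "h \<in> comet_shape V c e" for h
    using that V by (auto simp: comet_shape_def full_star_def)
  have no_c: "h = e" if "h \<in> comet_shape V c e" "c \<notin> h" for h
    using shape[OF that(1)] that(2) V(3) fin card_subset_eq[of e h] by auto
  have meets_e: "h \<subseteq> insert c e" if "h \<in> comet_shape V c e" "h \<inter> e \<noteq> {}" for h
    using shape(1)[OF that(1)] that(2) by blast
  have two: "card (h \<inter> e) \<noteq> 1" if h: "h \<in> comet_shape V c e" for h
  proof
    assume c1: "card (h \<inter> e) = 1"
    then have "h \<subseteq> insert c (h \<inter> e)" using meets_e[OF h] by fastforce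
    then have "card h \<le> card (insert c (h \<inter> e))" using fin by (intro card_mono) auto
    then show False using c1 shape(2)[OF h] fin by (simp add: card_insert_if split: if_splits)
  qed
  have "three_graph V (comet_shape V c e)" using shape V(1) by (auto simp: three_graph_def)
  moreover have "path_free (comet_shape V c e)"
    unfolding path_free_def
  proof (intro ballI impI, elim conjE)
    fix h1 h2 g assume h: "h1 \<in> comet_shape V c e" "h2 \<in> comet_shape V c e" "g \<in> comet_shape V c e"
      "h1 \<inter> h2 = {}" "g \<inter> h1 \<noteq> {}" "g \<inter> h2 \<noteq> {}"
    \<comment> \<open>One of two disjoint edges misses c and is therefore e. An edge g meeting e
      stays in \<open>insert c e\<close>, so it reaches the other edge only through c.\<close>
    from h(4) consider "c \<notin> h1" | "c \<notin> h2" by blast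
    then show "g \<subseteq> h1 \<union> h2"
    proof cases
      case 1
      then have "h1 = e" using no_c h(1) by blast
      then show ?thesis using meets_e[OF h(3)] h(4-6) by blast
    next
      case 2
      then have "h2 = e" using no_c h(2) by blast
      then show ?thesis using meets_e[OF h(3)] h(4-6) by blast
    qed
  qed
  moreover have "triangle_free (comet_shape V c e)"
    unfolding triangle_free_def
  proof (intro ballI allI impI, elim conjE)
    fix h1 h2 h3 x y z assume h: "h1 \<in> comet_shape V c e" "h2 \<in> comet_shape V c e" "h3 \<in> comet_shape V c e"
      "h1 \<inter> h2 = {x}" "h2 \<inter> h3 = {y}" "h3 \<inter> h1 = {z}"
    \<comment> \<open>No edge meets e in exactly one vertex, so e takes no part in a loose triangle,
      and all other edges share c.\<close>
    have "h1 \<noteq> e" "h2 \<noteq> e" "h3 \<noteq> e" using two[OF h(1)] two[OF h(2)] two[OF h(3)] h(4-6) by auto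
    then have "c \<in> h1" "c \<in> h2" "c \<in> h3" using no_c h(1-3) by blast+
    then have "c \<in> h1 \<inter> h2" "c \<in> h2 \<inter> h3" by blast+
    then show "x = y" unfolding h(4,5) by simp
  qed
  ultimately show ?thesis by (simp add: pc_free_def)
qed

lemma card_comet_shape:
  assumes V: "finite V" "e \<subseteq> V" "card e = 3" "c \<in> V - e"
  shows "card (comet_shape V c e) = 4 + ((card V - 4) choose 2)"
proof -
  have fin: "finite e" using V finite_subset by blast
  have fs: "finite (full_star (V - e) c)" "card (full_star (V - e) c) = (card (V - e) - 1) choose 2"
    using card_full_star[of "V - e" c] V by auto
  have "{h. h \<subseteq> insert c e \<and> card h = 3} \<inter> full_star (V - e) c = {}"
  proof (rule ccontr)
    assume "\<not> ?thesis"
    then obtain h where "h \<subseteq> insert c e" "card h = 3" "h \<subseteq> V - e" by (auto simp: full_star_def)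
    then have "h \<subseteq> {c}" by blast
    then have "card h \<le> 1" using card_mono[of "{c}" h] by simp
    then show False using \<open>card h = 3\<close> by simp
  qed
  moreover have "finite {h. h \<subseteq> insert c e \<and> card h = 3}" using fin by simp
  ultimately have "card (comet_shape V c e) = card {h. h \<subseteq> insert c e \<and> card h = 3} + card (full_star (V - e) c)"
    unfolding comet_shape_def using fs(1) by (intro card_Un_disjoint) auto
  moreover have "card {h. h \<subseteq> insert c e \<and> card h = 3} = 4"
    using n_subsets[of "insert c e" 3] fin V by (simp add: eval_nat_numeral)
  moreover have "card (V - e) - 1 = card V - 4" using V fin by (simp add: card_Diff_subset)
  ultimately show ?thesis using fs(2) by simp
qed

lemma comet_shape_has_matching:
  assumes V: "finite V" "e \<subseteq> V" "card e = 3" "c \<in> V - e" "6 \<le> card V"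
  shows "has_matching (comet_shape V c e)"
proof -
  have fin: "finite e" using V finite_subset by blast
  have "2 \<le> card (V - insert c e)" using V fin by (subst card_Diff_subset) auto
  then obtain s where s: "s \<subseteq> V - insert c e" "card s = 2" "finite s" using obtain_subset_with_card_n by metis
  have "e \<in> comet_shape V c e" using V by (auto simp: comet_shape_def)
  moreover have "c \<notin> s" using s(1) by blast
  then have "insert c s \<in> full_star (V - e) c" using s V by (auto simp: full_star_def)
  then have "insert c s \<in> comet_shape V c e" by (simp add: comet_shape_def)
  moreover have "e \<inter> insert c s = {}" using s V by blast
  ultimately show ?thesis unfolding has_matching_def by blast
qed

lemma comet_eq_shape: "comet n = comet_shape {0..<n} 0 {1, 2, 3}" if "4 \<le> n"
proof -
  have "{{0, u, v} | u v. u \<in> {4..<n} \<and> v \<in> {4..<n} \<and> u \<noteq> v} = full_star ({0..<n} - {1, 2, 3}) 0" (is "?L = ?R")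
  proof (intro equalityI subsetI)
    fix h assume "h \<in> ?L"
    then show "h \<in> ?R" using that by (auto simp: full_star_def)
  next
    fix h assume "h \<in> ?R"
    then have h: "h \<subseteq> {0..<n} - {1, 2, 3}" "card h = 3" "0 \<in> h" by (auto simp: full_star_def)
    have "card (h - {0}) = 2" using h by simp
    then obtain u v where uv: "h - {0} = {u, v}" "u \<noteq> v" by (auto simp: card_2_iff)
    then have "h = {0, u, v}" using h(3) by auto
    moreover have "u \<in> {4..<n}" "v \<in> {4..<n}"
    proof -
      have "u \<in> h - {0}" "v \<in> h - {0}" using uv by auto
      then have "u \<in> {0..<n} - {0, 1, 2, 3}" "v \<in> {0..<n} - {0, 1, 2, 3}" using h(1) by auto
      then show "u \<in> {4..<n}" "v \<in> {4..<n}" by auto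
    qed
    ultimately show "h \<in> ?L" using uv(2) by blast
  qed
  then show ?thesis by (simp add: comet_def comet_shape_def)
qed

text \<open>One inclusion suffices, because \<open>card_comet_shape\<close> makes both sides equally
  large.\<close>

lemma image_comet_shape:
  assumes V: "finite V" "e \<subseteq> V" "card e = 3" "c \<in> V - e" and f: "inj_on f V"
  shows "(`) f ` comet_shape V c e = comet_shape (f ` V) (f c) (f ` e)"
proof (rule card_subset_eq)
  have V': "finite (f ` V)" "f ` e \<subseteq> f ` V" "card (f ` e) = 3" "f c \<in> f ` V - f ` e"
    using V f by (auto simp: card_image inj_on_subset inj_on_image_mem_iff)
  have sub: "h \<subseteq> V" "card h = 3" if "h \<in> comet_shape V c e" for h
    using that V by (auto simp: comet_shape_def full_star_def)
  show "finite (comet_shape (f ` V) (f c) (f ` e))"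
    using three_graphD(5)[OF pc_freeD(1)[OF comet_shape_pc_free[OF V']]] .
  have diff: "f ` (V - e) = f ` V - f ` e" using inj_on_image_set_diff[OF f] V by blast
  show "(`) f ` comet_shape V c e \<subseteq> comet_shape (f ` V) (f c) (f ` e)"
  proof
    fix k assume "k \<in> (`) f ` comet_shape V c e"
    then obtain h where h: "h \<in> comet_shape V c e" "k = f ` h" by blast
    have "card k = 3" using sub[OF h(1)] f h(2) by (metis card_image inj_on_subset)
    moreover have "k \<subseteq> insert (f c) (f ` e) \<or> (f c \<in> k \<and> k \<subseteq> f ` (V - e))"
      using h by (auto simp: comet_shape_def full_star_def)
    ultimately show "k \<in> comet_shape (f ` V) (f c) (f ` e)"
      unfolding diff by (auto simp: comet_shape_def full_star_def)
  qed
  have "inj_on ((`) f) (comet_shape V c e)"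
    using inj_on_image_Pow[OF f] sub by (meson PowI inj_on_subset subsetI)
  then have "card ((`) f ` comet_shape V c e) = card (comet_shape V c e)" by (rule card_image)
  also have "\<dots> = card (comet_shape (f ` V) (f c) (f ` e))"
    using card_comet_shape[OF V] card_comet_shape[OF V'] f by (simp add: card_image)
  finally show "card ((`) f ` comet_shape V c e) = card (comet_shape (f ` V) (f c) (f ` e))" .
qed

lemma is_comet_iff_iso:
  assumes n: "4 \<le> n"
  shows "is_comet {0..<n} E \<longleftrightarrow> hypergraph3 n E \<and> iso_hg n E (comet n)"
proof
  let ?V = "{0..<n}"
  assume "is_comet ?V E"
  then obtain c e where e: "e \<subseteq> ?V" "card e = 3" "c \<in> ?V - e" "E = comet_shape ?V c e" by (auto simp: is_comet_def)
  have fin: "finite e" using e(1) finite_subset by blast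
  obtain g1 where g1: "bij_betw g1 e {1, 2, 3 :: nat}"
    using finite_same_card_bij[OF fin, of "{1, 2, 3 :: nat}"] e(2) by auto
  have "card (?V - insert c e) = card (?V - {0, 1, 2, 3})"
    using e fin n by (subst (1 2) card_Diff_subset) auto
  then obtain g2 where g2: "bij_betw g2 (?V - insert c e) (?V - {0, 1, 2, 3})"
    using finite_same_card_bij[of "?V - insert c e"] by auto
  define f where "f v = (if v \<in> e then g1 v else if v = c then 0 else g2 v)" for v
  have f: "bij_betw f e {1, 2, 3}" "bij_betw f {c} {0}" "bij_betw f (?V - insert c e) (?V - {0, 1, 2, 3})"
  proof -
    show "bij_betw f e {1, 2, 3}" using g1 by (rule bij_betw_cong[THEN iffD1, rotated]) (simp add: f_def)
    show "bij_betw f {c} {0}" using e(3) by (simp add: f_def bij_betw_def)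
    show "bij_betw f (?V - insert c e) (?V - {0, 1, 2, 3})"
      using g2 by (rule bij_betw_cong[THEN iffD1, rotated]) (simp add: f_def)
  qed
  have "bij_betw f (e \<union> {c} \<union> (?V - insert c e)) ({1, 2, 3} \<union> {0} \<union> (?V - {0, 1, 2, 3}))"
    by (intro bij_betw_combine f) auto
  moreover have "e \<union> {c} \<union> (?V - insert c e) = ?V" using e by blast
  moreover have "{1, 2, 3} \<union> {0} \<union> (?V - {0, 1, 2, 3}) = ?V" using n by auto
  ultimately have fV: "bij_betw f ?V ?V" by simp
  have "(`) f ` E = comet_shape (f ` ?V) (f c) (f ` e)"
    unfolding e(4) by (rule image_comet_shape[OF _ e(1-3)]) (use fV in \<open>auto simp: bij_betw_def\<close>)
  also have "\<dots> = comet n" unfolding comet_eq_shape[OF n] using f fV by (simp add: bij_betw_def)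
  finally have "iso_hg n E (comet n)" unfolding iso_hg_def using fV by blast
  moreover have "hypergraph3 n E"
    using comet_shape_pc_free[OF _ e(1-3)] by (auto simp: e(4) hypergraph3_def pc_free_def three_graph_def)
  ultimately show "hypergraph3 n E \<and> iso_hg n E (comet n)" by simp
next
  let ?V = "{0..<n}"
  assume "hypergraph3 n E \<and> iso_hg n E (comet n)"
  then obtain f where E: "hypergraph3 n E" and f: "bij_betw f ?V ?V" "(`) f ` E = comet n" by (auto simp: iso_hg_def)
  let ?g = "inv_into ?V f"
  have g: "bij_betw ?g ?V ?V" using bij_betw_inv_into[OF f(1)] .
  \<comment> \<open>\<open>inv_into\<close> undoes f only on subsets of {0..<n};
    \<open>hypergraph3\<close> ensures that the edges are such subsets.\<close>
  have "?g ` (f ` h) = h" if "h \<in> E" for h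
    using that E f(1) by (intro inv_into_image_cancel) (auto simp: hypergraph3_def bij_betw_def)
  then have "E = (`) ?g ` ((`) f ` E)" by (simp add: image_image)
  also have "\<dots> = comet_shape (?g ` ?V) (?g 0) (?g ` {1, 2, 3})"
    unfolding f(2) comet_eq_shape[OF n] by (rule image_comet_shape) (use n g in \<open>auto simp: bij_betw_def\<close>)
  finally have E_eq: "E = comet_shape ?V (?g 0) (?g ` {1, 2, 3})" using g by (simp add: bij_betw_def)
  have inj: "inj_on ?g ?V" and im: "?g ` ?V = ?V" using g by (auto simp: bij_betw_def)
  have sub: "{1, 2, 3} \<subseteq> ?V" "0 \<in> ?V" using n by auto
  have "card (?g ` {1, 2, 3}) = 3" using card_image[OF inj_on_subset[OF inj sub(1)]] by simp
  moreover have "?g ` {1, 2, 3} \<subseteq> ?V" using image_mono[OF sub(1), of ?g] im by blast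
  moreover have "?g 0 \<in> ?V - ?g ` {1, 2, 3}"
    using inj_on_image_mem_iff[OF inj sub(2,1)] imageI[OF sub(2), of ?g] unfolding im by simp
  ultimately show "is_comet ?V E" unfolding is_comet_def using E_eq by blast
qed

theorem mainTheorem6:
  shows "(\<forall>n. 6 \<le> n \<and> n \<le> 9 \<longrightarrow> ex3 n = 2 * n - 4)
    \<and> ex3 10 = 20
    \<and> (\<forall>n\<ge>11. ex3 n = 4 + ((n - 4) choose 2)
          \<and> Ex3 n = {E. hypergraph3 n E \<and> iso_hg n E (comet n)})"
proof (intro conjI allI impI)
  have upper: "card E \<le> turan_M n" "11 \<le> n \<Longrightarrow> card E = turan_M n \<Longrightarrow> is_comet {0..<n} E" if "admissible n E" for n E
    using card_le_turan_M[of "{0..<n}" E] that by (auto simp: admissible_iff)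
  show "ex3 n = 2 * n - 4" if "6 \<le> n \<and> n \<le> 9" for n
    using upper(1)[of n] two_books_admissible[of n] that by (intro ex3_eqI) (auto simp: turan_M_def)
  show "ex3 10 = 20"
    using upper(1)[of 10] two_cliques_admissible by (intro ex3_eqI[of 10 20 two_cliques]) auto
  fix n :: nat assume n: "11 \<le> n"
  have tn: "turan_M n = 4 + ((n - 4) choose 2)" using n by (simp add: turan_M_def)
  have comet: "admissible n E \<and> card E = turan_M n" if "is_comet {0..<n} E" for E
    using that n comet_shape_pc_free[of "{0..<n}"] comet_shape_has_matching[of "{0..<n}"] card_comet_shape[of "{0..<n}"]
    by (auto simp: is_comet_def admissible_iff tn)
  have "is_comet {0..<n} (comet n)"
    unfolding is_comet_def comet_eq_shape[OF order_trans[OF _ n, of 4, simplified]]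
    by (rule exI[of _ 0], rule exI[of _ "{1, 2, 3}"]) (use n in auto)
  then show ex: "ex3 n = 4 + ((n - 4) choose 2)"
    using comet[of "comet n"] upper(1)[of n] unfolding tn by (intro ex3_eqI[of n _ "comet n"]) simp_all
  have "admissible n E \<and> card E = turan_M n \<longleftrightarrow> is_comet {0..<n} E" for E
    using comet[of E] upper(2)[of n E] n by blast
  then show "Ex3 n = {E. hypergraph3 n E \<and> iso_hg n E (comet n)}"
    unfolding Ex3_def ex tn[symmetric] using is_comet_iff_iso[of n] n by simp
qed

end
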